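(* There is a polynomial-time algorithm which, given a hypertree $\mathcal{H}=(X,\mathcal{E})$ with $m$ edges (together with a host tree), outputs a C-coloring $\varphi$ of $\mathcal{H}$ with decrement $|X|-|\varphi(X)|\le (1+\ln m)\cdot\mathrm{dec}(\mathcal{H})$.
   Context: A hypergraph $\mathcal{H}=(X,\mathcal{E})$ has a finite vertex set $X$, $|X|=n$, and a family $\mathcal{E}$ of $m$ edges, each a subset of $X$ with at least 2 vertices. It is a hypertree if there is a tree $T$ on vertex set $X$ (a host tree) such that each edge of $\mathcal{H}$ induces a connected subgraph of $T$. A C-coloring of $\mathcal{H}$ is a map $\varphi:X\to\mathbb{N}$ such that every edge contains two distinct vertices of the same color. The upper chromatic number $\overline{\chi}(\mathcal{H})$ is the maximum number of colors used by a C-coloring, and $\mathrm{dec}(\mathcal{H})=n-\overline{\chi}(\mathcal{H})$. $\ln$ is the natural logarithm. *)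

theory Defs
  imports Complex_Main
begin

definition C_coloring :: "'a set list \<Rightarrow> ('a \<Rightarrow> nat) \<Rightarrow> bool" where
  "C_coloring Es \<phi> \<longleftrightarrow> (\<forall>e\<in>set Es. \<exists>x\<in>e. \<exists>y\<in>e. x \<noteq> y \<and> \<phi> x = \<phi> y)"

definition upper_chi :: "'a set \<Rightarrow> 'a set list \<Rightarrow> nat" where
  "upper_chi X Es = Max {card (\<phi> ` X) | \<phi>. C_coloring Es \<phi>}"

definition dec :: "'a set \<Rightarrow> 'a set list \<Rightarrow> nat" where
  "dec X Es = card X - upper_chi X Es"

definition hypergraph :: "'a set \<Rightarrow> 'a set list \<Rightarrow> bool" where
  "hypergraph X Es \<longleftrightarrow> finite X \<and> (\<forall>e\<in>set Es. e \<subseteq> X \<and> card e \<ge> 2)"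

definition reach_in :: "'a set set \<Rightarrow> 'a set \<Rightarrow> 'a \<Rightarrow> 'a \<Rightarrow> bool" where
  "reach_in T S = (\<lambda>x y. x \<in> S \<and> y \<in> S \<and> {x, y} \<in> T)\<^sup>*\<^sup>*"

definition induces_connected :: "'a set set \<Rightarrow> 'a set \<Rightarrow> bool" where
  "induces_connected T S \<longleftrightarrow> (\<forall>x\<in>S. \<forall>y\<in>S. reach_in T S x y)"

definition is_tree :: "'a set \<Rightarrow> 'a set set \<Rightarrow> bool" where
  "is_tree X T \<longleftrightarrow> finite X \<and> X \<noteq> {} \<and>
     (\<forall>t\<in>T. t \<subseteq> X \<and> card t = 2) \<and> induces_connected T X \<and> card T = card X - 1"

definition host_tree :: "'a set \<Rightarrow> 'a set list \<Rightarrow> 'a set set \<Rightarrow> bool" where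
  "host_tree X Es T \<longleftrightarrow> is_tree X T \<and> (\<forall>e\<in>set Es. induces_connected T e)"

definition hypertree :: "'a set \<Rightarrow> 'a set list \<Rightarrow> bool" where
  "hypertree X Es \<longleftrightarrow> hypergraph X Es \<and> (\<exists>T. host_tree X Es T)"

datatype instr =
    Const nat nat
  | Add nat nat nat
  | Sub nat nat nat
  | Load nat nat
  | Store nat nat
  | Jz nat nat
  | Jmp nat

type_synonym config = "nat \<times> (nat \<Rightarrow> nat)"

fun exec :: "instr \<Rightarrow> config \<Rightarrow> config" where
  "exec (Const i c) (pc, R) = (Suc pc, R(i := c))"
| "exec (Add i j k) (pc, R) = (Suc pc, R(i := R j + R k))"
| "exec (Sub i j k) (pc, R) = (Suc pc, R(i := R j - R k))"
| "exec (Load i j) (pc, R) = (Suc pc, R(i := R (R j)))"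
| "exec (Store i j) (pc, R) = (Suc pc, R(R i := R j))"
| "exec (Jz i l) (pc, R) = (if R i = 0 then (l, R) else (Suc pc, R))"
| "exec (Jmp l) (pc, R) = (l, R)"

definition step :: "instr list \<Rightarrow> config \<Rightarrow> config" where
  "step P s = (if fst s < length P then exec (P ! fst s) s else s)"

definition run :: "instr list \<Rightarrow> nat \<Rightarrow> config \<Rightarrow> config" where
  "run P t s = (step P ^^ t) s"

definition halted :: "instr list \<Rightarrow> config \<Rightarrow> bool" where
  "halted P s \<longleftrightarrow> fst s \<ge> length P"

definition init :: "nat list \<Rightarrow> config" where
  "init w = (0, (\<lambda>a. if a = 0 then length w else if a \<le> length w then w ! (a - 1) else 0))"

section \<open>Input encoding of a hypergraph on {0..<n} with a host tree\<close>

definition enc :: "nat \<Rightarrow> nat set list \<Rightarrow> (nat \<times> nat) list \<Rightarrow> nat list" where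
  "enc n Es Tl = [n, length Es]
     @ concat (map (\<lambda>e. length (sorted_list_of_set e) # sorted_list_of_set e) Es)
     @ [length Tl] @ concat (map (\<lambda>(u, v). [u, v]) Tl)"

definition tree_edges :: "(nat \<times> nat) list \<Rightarrow> nat set set" where
  "tree_edges Tl = {{u, v} | u v. (u, v) \<in> set Tl}"

end

theory Submission
  imports Defs
begin

text \<open>
  If \<open>F\<close> is a set of host tree edges such that every hyperedge contains a member of \<open>F\<close>, then
  colouring the components of \<open>(X, F)\<close> with distinct colours is a C-colouring of decrement at most
  \<open>|F|\<close>. Conversely, root the tree and take an optimal C-colouring: in every colour class choose a
  vertex of minimum depth, and let \<open>F\<close> consist of the parent edges of all vertices not chosen.
  A subtree containing two vertices of one class contains the parent of the deeper one, so \<open>F\<close>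
  meets every hyperedge, and \<open>|F| = dec\<close>. Hence \<open>dec\<close> is the optimum of a set cover problem with
  \<open>m\<close> elements, for which the greedy algorithm loses a factor \<open>H\<^sub>m \<le> 1 + ln m\<close>: the potential
  \<open>\<Sum>f\<in>F. H (number of uncovered hyperedges containing f)\<close> of an optimal \<open>F\<close> drops by at least
  one with every greedy choice.

  The machine runs greedy by thresholds: for \<open>s = m, \<dots>, 1\<close> it goes once through the tree edges and
  takes every edge that still covers \<open>s\<close> hyperedges. Coverage only decreases, so each edge taken
  has maximum coverage.
\<close>

section \<open>A loop language compiled to the register machine\<close>

text \<open>
  A store consists of scalars (registers \<open>0, \<dots>, 30\<close>) and a heap, whose cell \<open>a\<close> is register
  \<open>32 + a\<close>, so that heap writes cannot clobber scalars. Register \<open>31\<close> is scratch space of the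
  compiled code.
\<close>

type_synonym store = "(nat \<Rightarrow> nat) \<times> (nat \<Rightarrow> nat)"

datatype com =
    Set nat nat
  | Plus nat nat nat
  | Minus nat nat nat
  | Get nat nat
  | Put nat nat
  | Seq com com  (infixr \<open>;;\<close> 60)
  | Cond nat com com
  | Repeat nat com

definition decr :: "nat \<Rightarrow> store \<Rightarrow> store" where
  "decr r st = ((fst st)(r := fst st r - 1), snd st)"

primrec sem :: "com \<Rightarrow> store \<Rightarrow> store" where
  "sem (Set i c) st = ((fst st)(i := c), snd st)"
| "sem (Plus i j k) st = ((fst st)(i := fst st j + fst st k), snd st)"
| "sem (Minus i j k) st = ((fst st)(i := fst st j - fst st k), snd st)"
| "sem (Get i j) st = ((fst st)(i := snd st (fst st j)), snd st)"
| "sem (Put i j) st = (fst st, (snd st)(fst st i := fst st j))"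
| "sem (c ;; d) st = sem d (sem c st)"
| "sem (Cond r c d) st = (if fst st r \<noteq> 0 then sem c st else sem d st)"
| "sem (Repeat r c) st = ((\<lambda>st. decr r (sem c st)) ^^ fst st r) st"

text \<open>
  The \<open>Repeat\<close> equations describe the compiled loop (test \<open>r\<close>, body, decrement \<open>r\<close>) only if the
  body does not write \<open>r\<close>.
\<close>

primrec tm :: "com \<Rightarrow> store \<Rightarrow> nat" where
  "tm (Set i c) st = 1"
| "tm (Plus i j k) st = 1"
| "tm (Minus i j k) st = 1"
| "tm (Get i j) st = 3"
| "tm (Put i j) st = 3"
| "tm (c ;; d) st = tm c st + tm d (sem c st)"
| "tm (Cond r c d) st = (if fst st r \<noteq> 0 then tm c st + 2 else tm d st + 1)"
| "tm (Repeat r c) st =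
     1 + (\<Sum>k<fst st r. tm c (((\<lambda>st. decr r (sem c st)) ^^ k) st) + 4)"

primrec wr :: "com \<Rightarrow> nat set" where
  "wr (Set i c) = {i}"
| "wr (Plus i j k) = {i}"
| "wr (Minus i j k) = {i}"
| "wr (Get i j) = {i}"
| "wr (Put i j) = {}"
| "wr (c ;; d) = wr c \<union> wr d"
| "wr (Cond r c d) = wr c \<union> wr d"
| "wr (Repeat r c) = insert r (wr c)"

primrec wf_com :: "com \<Rightarrow> bool" where
  "wf_com (Set i c) = (i < 31)"
| "wf_com (Plus i j k) = (i < 31 \<and> j < 31 \<and> k < 31)"
| "wf_com (Minus i j k) = (i < 31 \<and> j < 31 \<and> k < 31)"
| "wf_com (Get i j) = (i < 31 \<and> j < 31)"
| "wf_com (Put i j) = (i < 31 \<and> j < 31)"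
| "wf_com (c ;; d) = (wf_com c \<and> wf_com d)"
| "wf_com (Cond r c d) = (r < 31 \<and> wf_com c \<and> wf_com d)"
| "wf_com (Repeat r c) = (r < 31 \<and> r \<notin> wr c \<and> wf_com c)"

lemma sem_frame: "r \<notin> wr c \<Longrightarrow> fst (sem c st) r = fst st r"
proof (induction c arbitrary: st)
  case (Repeat q c)
  have "fst (((\<lambda>st. decr q (sem c st)) ^^ k) st) r = fst st r" for k
    by (induction k) (use Repeat in \<open>auto simp: decr_def\<close>)
  then show ?case by simp
qed auto

text \<open>Peels off the first round, which is how the machine executes the loop. Since the body
  leaves \<open>r\<close> alone, the decremented counter is the number of rounds that
  remain.\<close>

lemma Repeat_unfold:
  assumes "r \<notin> wr c"
  shows "sem (Repeat r c) st = (if fst st r = 0 then st else sem (Repeat r c) (decr r (sem c st)))"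
    "tm (Repeat r c) st =
      (if fst st r = 0 then 1 else tm c st + 4 + tm (Repeat r c) (decr r (sem c st)))"
proof -
  have *: "fst (decr r (sem c st)) r = fst st r - 1"
    using assms by (simp add: decr_def sem_frame)
  show "sem (Repeat r c) st =
      (if fst st r = 0 then st else sem (Repeat r c) (decr r (sem c st)))"
    using * by (cases "fst st r") (auto simp: funpow_Suc_right simp del: funpow.simps)
  show "tm (Repeat r c) st =
      (if fst st r = 0 then 1 else tm c st + 4 + tm (Repeat r c) (decr r (sem c st)))"
    using * by (cases "fst st r") (auto simp: funpow_Suc_right sum.lessThan_Suc_shift
        simp del: sum.lessThan_Suc funpow.simps(2))
qed

text \<open>One rule for result and cost. The step premise supplies the frame condition, so an
  invariant only has to mention what the body changes; \<open>T\<close> bounds one round and 4 is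
  the loop overhead.\<close>

lemma Repeat_rule:
  assumes "wf_com (Repeat r c)" and "I 0 st"
    and step: "\<And>k st'. k < fst st r \<Longrightarrow> I k st' \<Longrightarrow> fst st' r = fst st r - k \<Longrightarrow>
      (\<And>x. x \<notin> wr c \<Longrightarrow> x \<noteq> r \<Longrightarrow> fst st' x = fst st x) \<Longrightarrow>
      I (Suc k) (decr r (sem c st')) \<and> tm c st' \<le> T"
  shows "I (fst st r) (sem (Repeat r c) st) \<and> tm (Repeat r c) st \<le> 1 + fst st r * (T + 4)"
proof -
  define f where "f = (\<lambda>st. decr r (sem c st))"
  have nw: "r \<notin> wr c" using assms by simp
  have inv: "k \<le> fst st r \<Longrightarrow> I k ((f ^^ k) st) \<and> fst ((f ^^ k) st) r = fst st r - k \<and>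
      (\<forall>x. x \<notin> wr c \<longrightarrow> x \<noteq> r \<longrightarrow> fst ((f ^^ k) st) x = fst st x)" for k
  proof (induction k)
    case 0
    then show ?case using assms(2) by simp
  next
    case (Suc k)
    then have IH: "I k ((f ^^ k) st)" "fst ((f ^^ k) st) r = fst st r - k"
      "\<And>x. x \<notin> wr c \<Longrightarrow> x \<noteq> r \<Longrightarrow> fst ((f ^^ k) st) x = fst st x" "k < fst st r" by auto
    show ?case using step[OF IH(4,1,2,3)] IH nw
      by (auto simp: f_def decr_def sem_frame)
  qed
  have "tm c ((f ^^ k) st) \<le> T" if "k < fst st r" for k
    using step[of k "(f ^^ k) st"] inv[of k] that by auto
  then have "(\<Sum>k<fst st r. tm c ((f ^^ k) st) + 4) \<le> (\<Sum>k<fst st r. T + 4)"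
    by (intro sum_mono) simp
  then show ?thesis using inv[of "fst st r"] by (simp add: f_def)
qed

section \<open>Compilation and its simulation proof\<close>

fun clen :: "com \<Rightarrow> nat" where
  "clen (Get i j) = 3"
| "clen (Put i j) = 3"
| "clen (c ;; d) = clen c + clen d"
| "clen (Cond r c d) = clen c + clen d + 2"
| "clen (Repeat r c) = clen c + 4"
| "clen _ = 1"

text \<open>Jump targets are absolute, hence the parameter \<open>pc\<close>. Register 31 holds
  either a heap address shifted by 32 or the constant 1 for the decrement.\<close>

primrec comp :: "com \<Rightarrow> nat \<Rightarrow> instr list" where
  "comp (Set i c) pc = [Const i c]"
| "comp (Plus i j k) pc = [Add i j k]"
| "comp (Minus i j k) pc = [Sub i j k]"
| "comp (Get i j) pc = [Const 31 32, Add 31 31 j, Load i 31]"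
| "comp (Put i j) pc = [Const 31 32, Add 31 31 i, Store 31 j]"
| "comp (c ;; d) pc = comp c pc @ comp d (pc + clen c)"
| "comp (Cond r c d) pc = [Jz r (pc + clen c + 2)] @ comp c (pc + 1) @
     [Jmp (pc + clen c + clen d + 2)] @ comp d (pc + clen c + 2)"
| "comp (Repeat r c) pc = [Jz r (pc + clen c + 4)] @ comp c (pc + 1) @
     [Const 31 1, Sub r r 31, Jmp pc]"

lemma length_comp [simp]: "length (comp c pc) = clen c"
  by (induction c arbitrary: pc) auto

definition code_at :: "instr list \<Rightarrow> nat \<Rightarrow> instr list \<Rightarrow> bool" where
  "code_at P pc xs \<longleftrightarrow> (\<exists>ys zs. P = ys @ xs @ zs \<and> length ys = pc)"

lemma code_at_append:
  "code_at P pc (xs @ ys) \<longleftrightarrow> code_at P pc xs \<and> code_at P (pc + length xs) ys"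
proof
  assume "code_at P pc (xs @ ys)"
  then obtain as bs where "P = as @ (xs @ ys) @ bs" "length as = pc"
    by (auto simp: code_at_def)
  then have "P = as @ xs @ (ys @ bs)" "P = (as @ xs) @ ys @ bs" "length (as @ xs) = pc + length xs"
    by auto
  then show "code_at P pc xs \<and> code_at P (pc + length xs) ys"
    unfolding code_at_def using \<open>length as = pc\<close> by blast
next
  assume "code_at P pc xs \<and> code_at P (pc + length xs) ys"
  then obtain as bs cs ds where *: "P = as @ xs @ bs" "length as = pc"
      "P = cs @ ys @ ds" "length cs = pc + length xs"
    unfolding code_at_def by blast
  then have "(as @ xs) @ bs = cs @ ys @ ds" "length (as @ xs) = length cs" by auto
  then have "bs = ys @ ds" using append_eq_append_conv by blast
  with * show "code_at P pc (xs @ ys)" unfolding code_at_def by auto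
qed

lemma code_at_Cons:
  "code_at P pc (x # xs) \<longleftrightarrow> pc < length P \<and> P ! pc = x \<and> code_at P (Suc pc) xs"
proof -
  have "code_at P pc [x] \<longleftrightarrow> pc < length P \<and> P ! pc = x"
    unfolding code_at_def
    by (auto simp: nth_append) (metis id_take_nth_drop length_take min.absorb4)
  then show ?thesis using code_at_append[of P pc "[x]" xs] by simp
qed

lemma run_add: "run P (a + b) s = run P b (run P a s)"
  by (simp add: run_def funpow_add add.commute[of a])

lemma run_Suc: "run P (Suc t) s = run P t (step P s)"
  by (simp add: run_def funpow_swap1)

lemma run_0: "run P 0 s = s"
  by (simp add: run_def)

lemmas run_simps = run_Suc run_0 step_def code_at_Cons

text \<open>Register 31 is left unconstrained, so compiled code may overwrite it freely.\<close>

definition repr :: "store \<Rightarrow> (nat \<Rightarrow> nat) \<Rightarrow> bool" where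
  "repr st R \<longleftrightarrow> (\<forall>i<31. R i = fst st i) \<and> (\<forall>a. R (32 + a) = snd st a)"

text \<open>Structural induction, with an inner induction on the counter for \<open>Repeat\<close>.
  Because the step count is exact, runs of subprograms chain by \<open>run_add\<close>, and bounds
  on \<open>tm\<close> are bounds on machine time.\<close>

lemma comp_correct:
  assumes "wf_com c" "code_at P pc (comp c pc)" "repr st R"
  shows "\<exists>R'. run P (tm c st) (pc, R) = (pc + clen c, R') \<and> repr (sem c st) R'"
  using assms
proof (induction c arbitrary: pc st R)
  case (Set i c)
  then show ?case by (auto simp: run_simps repr_def)
next
  case (Plus i j k)
  then show ?case by (auto simp: run_simps repr_def)
next
  case (Minus i j k)
  then show ?case by (auto simp: run_simps repr_def)
next
  case (Get i j)
  then show ?case by (auto simp: run_simps repr_def numeral_3_eq_3)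
next
  case (Put i j)
  then show ?case by (auto simp: run_simps repr_def numeral_3_eq_3)
next
  case (Seq c d)
  have wf: "wf_com c" "wf_com d"
    and at: "code_at P pc (comp c pc)" "code_at P (pc + clen c) (comp d (pc + clen c))"
    using Seq.prems by (auto simp: code_at_append)
  obtain R1 where R1: "run P (tm c st) (pc, R) = (pc + clen c, R1)" "repr (sem c st) R1"
    using Seq.IH(1)[OF wf(1) at(1) Seq.prems(3)] by blast
  obtain R2 where "run P (tm d (sem c st)) (pc + clen c, R1) = (pc + clen c + clen d, R2)"
      "repr (sem d (sem c st)) R2"
    using Seq.IH(2)[OF wf(2) at(2) R1(2)] by blast
  with R1 show ?case by (auto simp: run_add add.assoc)
next
  case (Cond r c d)
  show ?case
  proof (cases "fst st r = 0")
    case True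
    then have s: "run P 1 (pc, R) = (pc + clen c + 2, R)"
      using Cond.prems by (auto simp: run_simps repr_def)
    have "code_at P (pc + clen c + 2) (comp d (pc + clen c + 2))"
      using Cond.prems(2) by (simp add: code_at_append code_at_Cons)
    then obtain R' where "run P (tm d st) (pc + clen c + 2, R) = (pc + clen c + 2 + clen d, R')"
        "repr (sem d st) R'"
      using Cond.IH(2)[of "pc + clen c + 2" st R] Cond.prems by auto
    then have "run P (1 + tm d st) (pc, R) = (pc + clen (Cond r c d), R') \<and> repr (sem d st) R'"
      unfolding run_add s by (simp add: algebra_simps)
    then show ?thesis using True by auto
  next
    case False
    then have s: "run P 1 (pc, R) = (pc + 1, R)"
      using Cond.prems by (auto simp: run_simps repr_def)
    have "code_at P (pc + 1) (comp c (pc + 1))"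
      using Cond.prems(2) by (simp add: code_at_append code_at_Cons)
    then obtain R' where R': "run P (tm c st) (pc + 1, R) = (pc + 1 + clen c, R')"
        "repr (sem c st) R'"
      using Cond.IH(1)[of "pc + 1" st R] Cond.prems by auto
    have "run P 1 (pc + 1 + clen c, R') = (pc + clen c + clen d + 2, R')"
      using Cond.prems(2) by (simp add: code_at_append run_simps)
    then have "run P (1 + tm c st + 1) (pc, R) = (pc + clen (Cond r c d), R') \<and> repr (sem c st) R'"
      unfolding run_add s R' using R' by (simp add: algebra_simps)
    then show ?thesis using False by auto
  qed
next
  case (Repeat r c)
  have nw: "r \<notin> wr c" "r < 31" using Repeat.prems by auto
  have "\<exists>R'. run P (tm (Repeat r c) st) (pc, R) = (pc + clen c + 4, R') \<and>
      repr (sem (Repeat r c) st) R'"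
    using Repeat.prems(3)
  proof (induction "fst st r" arbitrary: st R)
    case 0
    then have "run P 1 (pc, R) = (pc + clen c + 4, R)"
      using Repeat.prems by (auto simp: run_simps repr_def)
    then show ?case
      using 0 Repeat_unfold[OF nw(1), of st] by (auto simp del: sem.simps tm.simps)
  next
    case (Suc k)
    have s: "run P 1 (pc, R) = (pc + 1, R)"
      using Suc.hyps Suc.prems Repeat.prems by (auto simp: run_simps repr_def)
    have "code_at P (pc + 1) (comp c (pc + 1))"
      using Repeat.prems(2) by (simp add: code_at_append code_at_Cons)
    then obtain R1 where R1: "run P (tm c st) (pc + 1, R) = (pc + 1 + clen c, R1)"
        "repr (sem c st) R1"
      using Repeat.IH[of "pc + 1" st R] Repeat.prems Suc.prems by auto
    define R2 where "R2 = R1(31 := 1, r := R1 r - 1)"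
    have R2: "run P 3 (pc + 1 + clen c, R1) = (pc, R2)"
      using Repeat.prems(2) nw by (simp add: code_at_append run_simps R2_def numeral_3_eq_3)
    have rep: "repr (decr r (sem c st)) R2"
      using R1(2) nw by (auto simp: repr_def decr_def R2_def)
    have "k = fst (decr r (sem c st)) r"
      using Suc.hyps nw by (simp add: decr_def sem_frame)
    from Suc.hyps(1)[OF this rep] obtain R' where R':
        "run P (tm (Repeat r c) (decr r (sem c st))) (pc, R2) = (pc + clen c + 4, R')"
        "repr (sem (Repeat r c) (decr r (sem c st))) R'" by blast
    have "tm (Repeat r c) st = 1 + tm c st + 3 + tm (Repeat r c) (decr r (sem c st))"
      using Repeat_unfold(2)[OF nw(1), of st] Suc.hyps by (simp del: tm.simps)
    then have "run P (tm (Repeat r c) st) (pc, R) = (pc + clen c + 4, R')"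
      by (simp only: run_add s R1 R2 R')
    then show ?case
      using R' Repeat_unfold(1)[OF nw(1), of st] Suc.hyps by (auto simp del: sem.simps tm.simps)
  qed
  then show ?case by (simp add: add.assoc del: sem.simps tm.simps)
qed

section \<open>Hitting sets of host tree edges\<close>

definition harmonic :: "nat \<Rightarrow> real" where
  "harmonic n = (\<Sum>k=1..n. 1 / real k)"

lemma harmonic_mono: "a \<le> b \<Longrightarrow> harmonic a \<le> harmonic b"
  unfolding harmonic_def by (intro sum_mono2) auto

text \<open>Induction: the new term \<open>1 / (n + 1)\<close> is at most
  \<open>ln (n + 1) - ln n\<close>, by \<open>ln x \<le> x - 1\<close> at
  \<open>x = n / (n + 1)\<close>.\<close>

lemma harmonic_le_ln: "n \<ge> 1 \<Longrightarrow> harmonic n \<le> 1 + ln (real n)"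
proof (induction n rule: dec_induct)
  case base
  then show ?case by (simp add: harmonic_def)
next
  case (step n)
  have "ln (real n / real (Suc n)) \<le> real n / real (Suc n) - 1"
    using step.hyps by (intro ln_le_minus_one) auto
  also have "\<dots> = - 1 / real (Suc n)" by (simp add: field_simps)
  finally have "ln (real n) - ln (real (Suc n)) \<le> - 1 / real (Suc n)"
    using step.hyps by (simp add: ln_div)
  then show ?case using step.IH by (simp add: harmonic_def)
qed

text \<open>The difference consists of the last \<open>b\<close> terms, each at least
  \<open>1 / q\<close>.\<close>

lemma harmonic_diff:
  assumes "b \<le> a" "a \<le> q"
  shows "harmonic a - harmonic (a - b) \<ge> real b / real q"
proof -
  have "{1..a} = {1..a - b} \<union> {a - b<..a}" "{1..a - b} \<inter> {a - b<..a} = {}" by auto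
  then have "harmonic a = harmonic (a - b) + (\<Sum>k\<in>{a - b<..a}. 1 / real k)"
    unfolding harmonic_def by (simp add: sum.union_disjoint)
  moreover have "(\<Sum>k\<in>{a - b<..a}. 1 / real k) \<ge> (\<Sum>k\<in>{a - b<..a}. 1 / real q)"
    using assms by (intro sum_mono frac_le) auto
  ultimately show ?thesis using assms by simp
qed

definition potential :: "('f \<Rightarrow> 'i set) \<Rightarrow> 'f set \<Rightarrow> 'i set \<Rightarrow> real" where
  "potential S F U = (\<Sum>f\<in>F. harmonic (card (S f \<inter> U)))"

text \<open>Each \<open>S f\<close> has at most \<open>card Q\<close> uncovered elements, so by
  \<open>harmonic_diff\<close> its term falls by at least
  \<open>card (S f \<inter> Q) / card Q\<close>. As \<open>F\<close> covers \<open>Q\<close>, these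
  fractions sum to at least 1.\<close>

lemma potential_greedy_step:
  assumes "finite F" "finite U" "U \<subseteq> (\<Union>f\<in>F. S f)" "Q \<subseteq> U" "Q \<noteq> {}"
    and max: "\<And>f. f \<in> F \<Longrightarrow> card (S f \<inter> U) \<le> card Q"
  shows "1 + potential S F (U - Q) \<le> potential S F U"
proof -
  have fQ: "finite Q" using assms finite_subset by blast
  have "harmonic (card (S f \<inter> U)) - harmonic (card (S f \<inter> (U - Q))) \<ge>
      real (card (S f \<inter> Q)) / real (card Q)" if "f \<in> F" for f
  proof -
    have "S f \<inter> (U - Q) = S f \<inter> U - S f \<inter> Q" by blast
    then have "card (S f \<inter> (U - Q)) = card (S f \<inter> U) - card (S f \<inter> Q)"
      using fQ assms(4) by (metis Int_mono card_Diff_subset finite_Int order_refl)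
    moreover have "card (S f \<inter> Q) \<le> card (S f \<inter> U)"
      using assms by (intro card_mono) auto
    ultimately show ?thesis using harmonic_diff max[OF that] by simp
  qed
  then have "(\<Sum>f\<in>F. real (card (S f \<inter> Q)) / real (card Q)) \<le>
      (\<Sum>f\<in>F. harmonic (card (S f \<inter> U)) - harmonic (card (S f \<inter> (U - Q))))"
    by (intro sum_mono)
  also have "\<dots> = potential S F U - potential S F (U - Q)"
    by (simp add: potential_def sum_subtractf)
  finally have *: "real (\<Sum>f\<in>F. card (S f \<inter> Q)) / real (card Q) \<le>
      potential S F U - potential S F (U - Q)"
    by (simp add: sum_divide_distrib)
  have "Q = (\<Union>f\<in>F. S f \<inter> Q)" using assms by blast
  then have "card Q \<le> (\<Sum>f\<in>F. card (S f \<inter> Q))"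
    using card_UN_le[OF assms(1), of "\<lambda>f. S f \<inter> Q"] by simp
  moreover have "card Q > 0" using fQ assms(5) by (simp add: card_gt_0_iff)
  ultimately have "1 \<le> real (\<Sum>f\<in>F. card (S f \<inter> Q)) / real (card Q)"
    by (simp add: field_simps del: of_nat_sum)
  then show ?thesis using * by linarith
qed

lemma potential_le:
  assumes "finite I"
  shows "potential S F I \<le> real (card F) * harmonic (card I)"
proof -
  have "potential S F I \<le> (\<Sum>f\<in>F. harmonic (card I))"
    unfolding potential_def using assms by (intro sum_mono harmonic_mono card_mono) auto
  then show ?thesis by simp
qed

section \<open>Rooted host trees and optimal C-colourings\<close>

text \<open>Depth is the distance from an arbitrary root, and a parent is the predecessor on a
  shortest walk. The edge count shows that every tree edge is a parent edge.\<close>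

lemma tree_parents:
  assumes "is_tree X T"
  obtains r :: 'a and par :: "'a \<Rightarrow> 'a" and depth :: "'a \<Rightarrow> nat"
  where "r \<in> X" and "\<And>v. v \<in> X \<Longrightarrow> depth v = 0 \<longleftrightarrow> v = r"
    and "\<And>v. v \<in> X \<Longrightarrow> v \<noteq> r \<Longrightarrow> par v \<in> X \<and> {v, par v} \<in> T \<and> depth v = Suc (depth (par v))"
    and "T = (\<lambda>v. {v, par v}) ` (X - {r})"
proof -
  have fin: "finite X" and ne: "X \<noteq> {}" and T: "\<And>t. t \<in> T \<Longrightarrow> t \<subseteq> X \<and> card t = 2"
    and conn: "\<And>x y. x \<in> X \<Longrightarrow> y \<in> X \<Longrightarrow> reach_in T X x y" and cT: "card T = card X - 1"
    using assms by (auto simp: is_tree_def induces_connected_def)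
  obtain r where r: "r \<in> X" using ne by blast
  define E where "E = (\<lambda>x y. x \<in> X \<and> y \<in> X \<and> {x, y} \<in> T)"
  define depth where "depth v = (LEAST k. (E ^^ k) r v)" for v
  have ex: "\<exists>k. (E ^^ k) r v" if "v \<in> X" for v
    using conn[OF r that] by (simp add: reach_in_def E_def rtranclp_power)
  have dep: "(E ^^ depth v) r v" if "v \<in> X" for v
    unfolding depth_def using ex[OF that] by (rule LeastI_ex)
  have dle: "(E ^^ k) r v \<Longrightarrow> depth v \<le> k" for k v
    unfolding depth_def by (rule Least_le)
  have d0: "depth v = 0 \<longleftrightarrow> v = r" if "v \<in> X" for v
    using dep[OF that] dle[of 0 v] by auto
  have "\<exists>p. p \<in> X \<and> {v, p} \<in> T \<and> depth v = Suc (depth p)" if v: "v \<in> X" "v \<noteq> r" for v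
  proof -
    obtain k where k: "depth v = Suc k" using d0 v by (cases "depth v") auto
    then obtain p where p: "(E ^^ k) r p" "E p v"
      using dep[OF v(1)] by auto
    then have "p \<in> X" "{v, p} \<in> T" by (auto simp: E_def insert_commute)
    moreover have "depth p \<le> k" using p dle by blast
    moreover have "depth v \<le> Suc (depth p)"
    proof (rule dle)
      show "(E ^^ Suc (depth p)) r v"
        using dep[OF \<open>p \<in> X\<close>] p(2) by auto
    qed
    ultimately show ?thesis using k by (intro exI[of _ p]) auto
  qed
  then obtain par where par: "\<And>v. v \<in> X \<Longrightarrow> v \<noteq> r \<Longrightarrow>
      par v \<in> X \<and> {v, par v} \<in> T \<and> depth v = Suc (depth (par v))"
    by metis
  \<comment> \<open>Two vertices sharing a parent edge would be parents of each other, so each would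
    be deeper than the other.\<close>
  have inj: "inj_on (\<lambda>v. {v, par v}) (X - {r})"
  proof (rule inj_onI)
    fix v w assume vw: "v \<in> X - {r}" "w \<in> X - {r}" and eq: "{v, par v} = {w, par w}"
    have "depth v = Suc (depth (par v))" "depth w = Suc (depth (par w))" using par vw by auto
    then show "v = w" using eq by (auto simp: doubleton_eq_iff)
  qed
  have "T \<subseteq> Pow X" using T by blast
  then have finT: "finite T" using fin finite_subset by blast
  have "(\<lambda>v. {v, par v}) ` (X - {r}) \<subseteq> T" using par by auto
  \<comment> \<open>The parent edges are \<open>card X - 1\<close> distinct members of
    \<open>T\<close>, so they exhaust it.\<close>
  moreover have "card ((\<lambda>v. {v, par v}) ` (X - {r})) = card T"
    using inj cT r fin by (simp add: card_image)
  ultimately have "T = (\<lambda>v. {v, par v}) ` (X - {r})"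
    using finT card_subset_eq by blast
  with that r d0 par show thesis by blast
qed

text \<open>\<open>Max\<close> is taken over a finite nonempty set: the numbers are at most
  \<open>card X\<close>, and the constant colouring qualifies because every hyperedge has two
  vertices.\<close>

lemma dec_attained:
  assumes "hypergraph X Es"
  obtains \<phi> where "C_coloring Es \<phi>" "card X - card (\<phi> ` X) = dec X Es"
proof -
  let ?M = "{card (\<phi> ` X) | \<phi>. C_coloring Es \<phi>}"
  have fin: "finite X" using assms by (simp add: hypergraph_def)
  have "?M \<subseteq> {..card X}" using fin by (auto intro: card_image_le)
  then have "finite ?M" using finite_subset by blast
  have "C_coloring Es (\<lambda>_. 0)"
    unfolding C_coloring_def
  proof
    fix e assume "e \<in> set Es"
    then have "\<not> card e \<le> Suc 0" "finite e"
      using assms fin by (auto simp: hypergraph_def intro: finite_subset)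
    then show "\<exists>x\<in>e. \<exists>y\<in>e. x \<noteq> y \<and> (0::nat) = 0"
      using card_le_Suc0_iff_eq by blast
  qed
  then have "?M \<noteq> {}" by blast
  from Max_in[OF \<open>finite ?M\<close> this] that show thesis by (auto simp: dec_def upper_chi_def)
qed

lemma exists_small_hitting_set:
  assumes "hypergraph X Es" "host_tree X Es T"
  shows "\<exists>F \<subseteq> T. finite F \<and> card F \<le> dec X Es \<and> (\<forall>e\<in>set Es. \<exists>t\<in>F. t \<subseteq> e)"
proof -
  have tree: "is_tree X T" and conn: "\<And>e. e \<in> set Es \<Longrightarrow> induces_connected T e"
    using assms by (auto simp: host_tree_def)
  have fin: "finite X" and sub: "\<And>e. e \<in> set Es \<Longrightarrow> e \<subseteq> X"
    using assms by (auto simp: hypergraph_def)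
  obtain r par depth where r: "r \<in> X"
    and d0: "\<And>v. v \<in> X \<Longrightarrow> depth v = 0 \<longleftrightarrow> v = r"
    and par: "\<And>v. v \<in> X \<Longrightarrow> v \<noteq> r \<Longrightarrow> par v \<in> X \<and> {v, par v} \<in> T \<and> depth v = Suc (depth (par v))"
    and T: "T = (\<lambda>v. {v, par v}) ` (X - {r})"
    by (rule tree_parents[OF tree]) (rule that)
  obtain \<phi> where phi: "C_coloring Es \<phi>" and dec: "card X - card (\<phi> ` X) = dec X Es"
    using dec_attained[OF assms(1)] by blast
  \<comment> \<open>\<open>up\<^sup>*\<^sup>* y x\<close> expresses that \<open>x\<close> is
    \<open>y\<close> or an ancestor of \<open>y\<close>.\<close>
  define up where "up = (\<lambda>v p. v \<in> X \<and> v \<noteq> r \<and> p = par v)"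
  have up_depth: "y = x \<or> depth x < depth y" if "up\<^sup>*\<^sup>* y x" for x y
    using that
  proof (induction rule: converse_rtranclp_induct)
    case (step y z)
    then show ?case using par[of y] by (auto simp: up_def)
  qed simp
  \<comment> \<open>A walk from \<open>x\<close> that avoids the parent of \<open>x\<close> never leaves the subtree below \<open>x\<close>.\<close>
  have parent_in: "x \<noteq> r \<and> par x \<in> e"
    if e: "e \<in> set Es" and xy: "x \<in> e" "y \<in> e" "x \<noteq> y" "depth y \<le> depth x" for e x y
  proof -
    have "x \<noteq> r"
    proof
      assume "x = r"
      then have "depth y = 0" using xy(4) d0[OF r] by simp
      then show False using d0[of y] sub[OF e] xy \<open>x = r\<close> by auto
    qed
    moreover have "par x \<in> e"
    proof (rule ccontr)
      assume np: "par x \<notin> e"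
      have "reach_in T e x y" using conn[OF e] xy by (auto simp: induces_connected_def)
      then have "up\<^sup>*\<^sup>* y x"
        unfolding reach_in_def
      proof (induction rule: rtranclp_induct)
        case base
        show ?case by simp
      next
        case (step y z)
        then obtain v where v: "v \<in> X" "v \<noteq> r" "{y, z} = {v, par v}" by (auto simp: T)
        then consider "v = y" "z = par y" | "v = z" "y = par z"
          by (auto simp: doubleton_eq_iff)
        then show ?case
        proof cases
          case 1
          \<comment> \<open>\<open>y = x\<close> would put \<open>par x\<close> into
            \<open>e\<close>. Hence the ancestor chain from \<open>y\<close> to \<open>x\<close>
            starts with \<open>par y\<close>, and \<open>z\<close> still lies below
            \<open>x\<close>.\<close>
          have "y \<noteq> x" using np 1 step.hyps(2) by auto
          then show ?thesis using step.IH 1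
            by (auto simp: up_def elim: converse_rtranclpE)
        next
          case 2
          then have "up z y" using v by (simp add: up_def)
          then show ?thesis using step.IH by (rule converse_rtranclp_into_rtranclp)
        qed
      qed
      from up_depth[OF this] have False using xy by auto
      then show False .
    qed
    ultimately show ?thesis by blast
  qed
  define rep where "rep c = arg_min_on depth {x \<in> X. \<phi> x = c}" for c
  have rep: "rep (\<phi> x) \<in> X \<and> \<phi> (rep (\<phi> x)) = \<phi> x \<and> depth (rep (\<phi> x)) \<le> depth x"
    if "x \<in> X" for x
  proof -
    have "finite {y \<in> X. \<phi> y = \<phi> x}" "{y \<in> X. \<phi> y = \<phi> x} \<noteq> {}" "x \<in> {y \<in> X. \<phi> y = \<phi> x}"
      using that fin by auto
    from arg_min_if_finite(1)[OF this(1,2), of depth] arg_min_least[OF this, of depth]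
    show ?thesis unfolding rep_def by blast
  qed
  \<comment> \<open>Every colour used on \<open>X\<close> has exactly one representative, so
    \<open>N\<close> has as many elements as there are vertices minus colours, which is
    \<open>dec\<close>.\<close>
  define N where "N = X - rep ` \<phi> ` X"
  define F where "F = (\<lambda>v. {v, par v}) ` N"
  have rep_sub: "rep ` \<phi> ` X \<subseteq> X" using rep by auto
  have "inj_on rep (\<phi> ` X)"
    by (rule inj_on_inverseI[of _ \<phi>]) (use rep in auto)
  then have "card N = dec X Es"
    unfolding N_def using rep_sub fin dec by (simp add: card_Diff_subset card_image finite_subset)
  moreover have "finite N" using fin by (simp add: N_def)
  ultimately have cF: "card F \<le> dec X Es" "finite F"
    unfolding F_def using card_image_le[of N "\<lambda>v. {v, par v}"] by simp_all
  \<comment> \<open>The root is the only vertex of depth 0 and so represents its class; hence every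
    vertex in \<open>N\<close> has a parent.\<close>
  have "r \<in> rep ` \<phi> ` X"
    using rep[OF r] d0[OF r] d0[of "rep (\<phi> r)"] r by (metis bot_nat_0.extremum_uniqueI imageI)
  then have "F \<subseteq> T" unfolding F_def N_def T by auto
  moreover have "\<exists>t\<in>F. t \<subseteq> e" if e: "e \<in> set Es" for e
  proof -
    obtain x y where "x \<in> e" "y \<in> e" "x \<noteq> y" "\<phi> x = \<phi> y"
      using phi e by (auto simp: C_coloring_def)
    then obtain x y where xy: "x \<in> e" "y \<in> e" "x \<noteq> y" "\<phi> x = \<phi> y" "depth y \<le> depth x"
      by (metis nat_le_linear)
    have X: "x \<in> X" "y \<in> X" using xy sub[OF e] by auto
    have "\<exists>v\<in>N. v \<in> e \<and> par v \<in> e"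
    proof (cases "x \<in> N")
      case True
      then show ?thesis using parent_in[OF e xy(1,2,3,5)] xy by blast
    next
      \<comment> \<open>If \<open>x\<close> is a representative, both vertices have the same depth
        and \<open>y\<close> is not a representative, so the two can exchange roles.\<close>
      case False
      have repD: "rep (\<phi> z) = z" if z: "z \<in> X" "z \<notin> N" for z
      proof -
        obtain w where "w \<in> X" "z = rep (\<phi> w)" using z by (auto simp: N_def)
        then show ?thesis using rep[of w] by simp
      qed
      have x: "rep (\<phi> x) = x" using repD[OF X(1) False] .
      then have "depth x \<le> depth y" using rep[OF X(2)] xy(4) by simp
      moreover have "y \<in> N"
      proof (rule ccontr)
        assume "y \<notin> N"
        then have "rep (\<phi> y) = y" by (rule repD[OF X(2)])
        then show False using x xy(3,4) by simp
      qed
      ultimately show ?thesis using parent_in[OF e xy(2,1)] xy by auto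
    qed
    then show ?thesis by (auto simp: F_def)
  qed
  ultimately show ?thesis using cF by blast
qed

section \<open>The greedy invariant\<close>

text \<open>Tree edges are named by list position and hyperedges by index, which matches the arrays
  of the machine.\<close>

definition hits :: "nat set list \<Rightarrow> (nat \<times> nat) list \<Rightarrow> nat \<Rightarrow> nat set" where
  "hits Es Tl j = {i. i < length Es \<and> fst (Tl ! j) \<in> Es ! i \<and> snd (Tl ! j) \<in> Es ! i}"

definition hitting :: "nat set list \<Rightarrow> (nat \<times> nat) list \<Rightarrow> nat set \<Rightarrow> bool" where
  "hitting Es Tl F \<longleftrightarrow> F \<subseteq> {..<length Tl} \<and> {..<length Es} \<subseteq> (\<Union>j\<in>F. hits Es Tl j)"

text \<open>\<open>U\<close> is the set of hyperedges not yet covered. The last clause says that the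
  colours lost so far are paid for by the drop in potential; it ranges over all \<open>F\<close>
  because the program does not know an optimal one.\<close>

definition greedy_inv ::
  "nat \<Rightarrow> nat set list \<Rightarrow> (nat \<times> nat) list \<Rightarrow> nat set \<Rightarrow> (nat \<Rightarrow> nat) \<Rightarrow> bool" where
  "greedy_inv n Es Tl U col \<longleftrightarrow> U \<subseteq> {..<length Es} \<and>
    (\<forall>i<length Es. i \<notin> U \<longrightarrow> (\<exists>x\<in>Es ! i. \<exists>y\<in>Es ! i. x \<noteq> y \<and> col x = col y)) \<and>
    (\<forall>F. hitting Es Tl F \<longrightarrow>
      real (n - card (col ` {0..<n})) + potential (hits Es Tl) F U
        \<le> potential (hits Es Tl) F {..<length Es})"

lemma greedy_inv_init:
  assumes "\<And>x. x < n \<Longrightarrow> col x = x"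
  shows "greedy_inv n Es Tl {..<length Es} col"
proof -
  have "col ` {0..<n} = {0..<n}" using assms by (force simp: image_def)
  then show ?thesis by (simp add: greedy_inv_def)
qed

text \<open>Giving the class of \<open>v\<close> the colour of \<open>u\<close> settles every
  hyperedge containing both and loses at most one colour, while the greedy choice lowers the
  potential by at least one.\<close>

lemma greedy_inv_step:
  assumes inv: "greedy_inv n Es Tl U col" and sub: "\<forall>e\<in>set Es. e \<subseteq> {0..<n}"
    and ne: "hits Es Tl j \<inter> U \<noteq> {}" and uv: "Tl ! j = (u, v)" "u \<noteq> v"
    and max: "\<And>j'. j' < length Tl \<Longrightarrow> card (hits Es Tl j' \<inter> U) \<le> card (hits Es Tl j \<inter> U)"
    and col': "\<And>x. x < n \<Longrightarrow> col' x = (if col x = col v then col u else col x)"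
  shows "greedy_inv n Es Tl (U - hits Es Tl j) col'"
  unfolding greedy_inv_def
proof (intro conjI allI impI)
  have U: "U \<subseteq> {..<length Es}" using inv by (simp add: greedy_inv_def)
  then show "U - hits Es Tl j \<subseteq> {..<length Es}" by auto
  obtain i0 where i0: "i0 < length Es" "u \<in> Es ! i0" "v \<in> Es ! i0"
    using ne uv by (auto simp: hits_def)
  then have "Es ! i0 \<subseteq> {0..<n}" using sub nth_mem by blast
  then have un: "u < n" "v < n" using i0 by auto
  show "\<exists>x\<in>Es ! i. \<exists>y\<in>Es ! i. x \<noteq> y \<and> col' x = col' y"
    if i: "i < length Es" "i \<notin> U - hits Es Tl j" for i
  proof (cases "i \<in> hits Es Tl j")
    case True
    then have "u \<in> Es ! i" "v \<in> Es ! i" using uv by (auto simp: hits_def)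
    moreover have "col' u = col' v" using col' un by simp
    ultimately show ?thesis using uv by blast
  next
    case False
    then obtain x y where xy: "x \<in> Es ! i" "y \<in> Es ! i" "x \<noteq> y" "col x = col y"
      using inv i unfolding greedy_inv_def by blast
    have "Es ! i \<subseteq> {0..<n}" using sub i nth_mem by blast
    then have "x < n" "y < n" using xy by auto
    then have "col' x = col' y" using col' xy by simp
    then show ?thesis using xy by blast
  qed
  fix F assume F: "hitting Es Tl F"
  \<comment> \<open>Only the old colour of \<open>v\<close> can disappear.\<close>
  have "col ` {0..<n} - {col v} \<subseteq> col' ` {0..<n}"
  proof
    fix c assume "c \<in> col ` {0..<n} - {col v}"
    then obtain x where "x < n" "c = col x" "c \<noteq> col v" by auto
    then have "col' x = c" using col' by simp
    then show "c \<in> col' ` {0..<n}" using \<open>x < n\<close> by auto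
  qed
  then have "card (col ` {0..<n} - {col v}) \<le> card (col' ` {0..<n})"
    by (intro card_mono) auto
  moreover have "card (col ` {0..<n} - {col v}) = card (col ` {0..<n}) - 1"
    using un by (intro card_Diff_singleton) auto
  ultimately have "n - card (col' ` {0..<n}) \<le> (n - card (col ` {0..<n})) + 1" by linarith
  then have loss: "real (n - card (col' ` {0..<n})) \<le> real (n - card (col ` {0..<n})) + 1"
    by linarith
  have "1 + potential (hits Es Tl) F (U - (hits Es Tl j \<inter> U)) \<le> potential (hits Es Tl) F U"
  proof (rule potential_greedy_step)
    show "finite F" using F finite_subset by (auto simp: hitting_def)
    show "finite U" using U finite_subset by blast
    show "U \<subseteq> (\<Union>f\<in>F. hits Es Tl f)" using F U by (auto simp: hitting_def)
    show "card (hits Es Tl f \<inter> U) \<le> card (hits Es Tl j \<inter> U)" if "f \<in> F" for f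
      using F that max by (auto simp: hitting_def)
  qed (use ne in auto)
  moreover have "U - (hits Es Tl j \<inter> U) = U - hits Es Tl j" by blast
  moreover have "real (n - card (col ` {0..<n})) + potential (hits Es Tl) F U
        \<le> potential (hits Es Tl) F {..<length Es}"
    using inv F by (simp add: greedy_inv_def)
  ultimately show "real (n - card (col' ` {0..<n})) + potential (hits Es Tl) F (U - hits Es Tl j)
        \<le> potential (hits Es Tl) F {..<length Es}"
    using loss by simp
qed

lemma exists_hitting:
  assumes "hypergraph {0..<n} Es" "host_tree {0..<n} Es (tree_edges Tl)"
  obtains F where "hitting Es Tl F" "card F \<le> dec {0..<n} Es"
proof -
  obtain F where F: "F \<subseteq> tree_edges Tl" "finite F" "card F \<le> dec {0..<n} Es"
      "\<forall>e\<in>set Es. \<exists>t\<in>F. t \<subseteq> e"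
    using exists_small_hitting_set[OF assms] by blast
  have "\<exists>j<length Tl. t = {fst (Tl ! j), snd (Tl ! j)}" if "t \<in> F" for t
  proof -
    obtain u v where "(u, v) \<in> set Tl" "t = {u, v}"
      using F(1) \<open>t \<in> F\<close> unfolding tree_edges_def by blast
    then show ?thesis by (metis fst_conv in_set_conv_nth snd_conv)
  qed
  then obtain ix where ix: "\<And>t. t \<in> F \<Longrightarrow> ix t < length Tl \<and> t = {fst (Tl ! ix t), snd (Tl ! ix t)}"
    by metis
  have "\<exists>j\<in>ix ` F. i \<in> hits Es Tl j" if i: "i < length Es" for i
  proof -
    obtain t where t: "t \<in> F" "t \<subseteq> Es ! i" using F(4) i nth_mem by blast
    have "{fst (Tl ! ix t), snd (Tl ! ix t)} \<subseteq> Es ! i" using ix[OF t(1)] t(2) by metis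
    then show ?thesis using t(1) i by (auto simp: hits_def)
  qed
  then have "hitting Es Tl (ix ` F)" using ix by (auto simp: hitting_def)
  moreover have "card (ix ` F) \<le> dec {0..<n} Es"
    using F card_image_le[of F ix] by linarith
  ultimately show thesis by (rule that)
qed

text \<open>Some hitting set exists, so a nonempty \<open>U\<close> would be met by a tree edge;
  thus \<open>none\<close> forces \<open>U\<close> to be empty. The loss is then bounded by the
  initial potential of a hitting set of size at most \<open>dec\<close>.\<close>

lemma greedy_inv_final:
  assumes inst: "hypergraph {0..<n} Es" "host_tree {0..<n} Es (tree_edges Tl)"
    and inv: "greedy_inv n Es Tl U col"
    and none: "\<And>j. j < length Tl \<Longrightarrow> card (hits Es Tl j \<inter> U) = 0"
    and eq: "\<And>x. x < n \<Longrightarrow> \<phi> x = col x"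
  shows "C_coloring Es \<phi> \<and>
    real (n - card (\<phi> ` {0..<n})) \<le> (1 + ln (real (length Es))) * real (dec {0..<n} Es)"
proof -
  obtain F where F: "hitting Es Tl F" "card F \<le> dec {0..<n} Es"
    using exists_hitting[OF inst] .
  have U: "U \<subseteq> {..<length Es}" using inv by (simp add: greedy_inv_def)
  then have "finite U" using finite_subset by blast
  then have "hits Es Tl j \<inter> U = {}" if "j < length Tl" for j
    using none[OF that] by simp
  then have "U = {}" using F(1) U unfolding hitting_def by fast
  have "C_coloring Es \<phi>"
    unfolding C_coloring_def
  proof
    fix e assume "e \<in> set Es"
    then obtain i where i: "i < length Es" "e = Es ! i" by (metis in_set_conv_nth)
    then obtain x y where xy: "x \<in> e" "y \<in> e" "x \<noteq> y" "col x = col y"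
      using inv \<open>U = {}\<close> unfolding greedy_inv_def by blast
    have "e \<subseteq> {0..<n}" using inst(1) \<open>e \<in> set Es\<close> by (auto simp: hypergraph_def)
    then have "x < n" "y < n" using xy by auto
    then show "\<exists>x\<in>e. \<exists>y\<in>e. x \<noteq> y \<and> \<phi> x = \<phi> y" using eq xy by metis
  qed
  moreover have "\<phi> ` {0..<n} = col ` {0..<n}" using eq by (intro image_cong) auto
  moreover have "potential (hits Es Tl) F {} = 0" by (simp add: potential_def harmonic_def)
  then have "real (n - card (col ` {0..<n})) \<le> potential (hits Es Tl) F {..<length Es}"
    using inv F(1) \<open>U = {}\<close> by (auto simp: greedy_inv_def)
  then have le: "real (n - card (col ` {0..<n})) \<le> real (card F) * harmonic (length Es)"
    using potential_le[of "{..<length Es}" "hits Es Tl" F] by simp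
  have "real (card F) * harmonic (length Es) \<le> (1 + ln (real (length Es))) * real (dec {0..<n} Es)"
  \<comment> \<open>Without hyperedges the left side is 0 because \<open>harmonic 0 = 0\<close>, and
    the convention \<open>ln 0 = 0\<close> keeps the right side nonnegative.\<close>
  proof (cases "Es = []")
    case True
    then show ?thesis by (simp add: harmonic_def)
  next
    case False
    then have "1 \<le> length Es" by (cases Es) auto
    then have "harmonic (length Es) \<le> 1 + ln (real (length Es))" "0 \<le> harmonic (length Es)"
      using harmonic_le_ln by (auto simp: harmonic_def sum_nonneg)
    then show ?thesis using F(2) by (subst mult.commute) (intro mult_mono, auto)
  qed
  ultimately show ?thesis using le by simp
qed

section \<open>Counting, marking and recolouring\<close>

definition seg :: "(nat \<Rightarrow> nat) \<Rightarrow> nat \<Rightarrow> nat list \<Rightarrow> bool" where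
  "seg h p xs \<longleftrightarrow> (\<forall>k<length xs. h (p + k) = xs ! k)"

lemma seg_Nil [simp]: "seg h p []"
  by (simp add: seg_def)

lemma seg_Cons: "seg h p (x # xs) \<longleftrightarrow> h p = x \<and> seg h (Suc p) xs"
  by (auto simp: seg_def nth_Cons less_Suc_eq_0_disj split: nat.splits)

lemma seg_append: "seg h p (xs @ ys) \<longleftrightarrow> seg h p xs \<and> seg h (p + length xs) ys"
proof (induction xs arbitrary: p)
  case (Cons x xs)
  then show ?case by (simp add: seg_Cons)
qed simp

lemma seg_cong: "(\<And>k. k < length xs \<Longrightarrow> h (p + k) = h' (p + k)) \<Longrightarrow> seg h p xs = seg h' p xs"
  by (simp add: seg_def)

text \<open>Register names are mere numerals, so that simplification decides which registers
  differ.\<close>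

abbreviation (input) "rB \<equiv> 0 :: nat"
abbreviation (input) "rInp \<equiv> 1 :: nat"
abbreviation (input) "rN \<equiv> 2 :: nat"
abbreviation (input) "rM \<equiv> 3 :: nat"
abbreviation (input) "rTlen \<equiv> 4 :: nat"
abbreviation (input) "rTree \<equiv> 5 :: nat"
abbreviation (input) "rCol \<equiv> 6 :: nat"
abbreviation (input) "rMark \<equiv> 7 :: nat"
abbreviation (input) "rOne \<equiv> 8 :: nat"
abbreviation (input) "rP \<equiv> 9 :: nat"
abbreviation (input) "rI \<equiv> 10 :: nat"
abbreviation (input) "rQ \<equiv> 11 :: nat"
abbreviation (input) "rCnt \<equiv> 12 :: nat"
abbreviation (input) "rLen \<equiv> 13 :: nat"
abbreviation (input) "rFu \<equiv> 14 :: nat"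
abbreviation (input) "rFv \<equiv> 15 :: nat"
abbreviation (input) "rX \<equiv> 16 :: nat"
abbreviation (input) "rD \<equiv> 17 :: nat"
abbreviation (input) "rE \<equiv> 18 :: nat"
abbreviation (input) "rU \<equiv> 19 :: nat"
abbreviation (input) "rV \<equiv> 20 :: nat"
abbreviation (input) "rFlag \<equiv> 21 :: nat"
abbreviation (input) "rS \<equiv> 22 :: nat"
abbreviation (input) "rJ \<equiv> 23 :: nat"
abbreviation (input) "rPt \<equiv> 24 :: nat"
abbreviation (input) "rCu \<equiv> 25 :: nat"
abbreviation (input) "rCv \<equiv> 26 :: nat"
abbreviation (input) "rK \<equiv> 27 :: nat"
abbreviation (input) "rZero \<equiv> 28 :: nat"
abbreviation (input) "rTwo \<equiv> 29 :: nat"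

text \<open>An equality test: the two truncated differences add up to 0 exactly when the registers
  agree.\<close>

definition dist_com :: "nat \<Rightarrow> nat \<Rightarrow> com" where
  "dist_com a b = Minus rD a b ;; Minus rE b a ;; Plus rD rD rE"

definition nop :: com where
  "nop = Set rE 0"

definition scan_body :: com where
  "scan_body = Get rX rP ;; Plus rP rP rOne ;;
     dist_com rX rU ;; Cond rD nop (Set rFu 1) ;;
     dist_com rX rV ;; Cond rD nop (Set rFv 1)"

definition scan :: com where
  "scan = Repeat rLen scan_body"

definition pass_body :: com where
  "pass_body = (Get rLen rP ;; Plus rP rP rOne ;; Set rFu 0 ;; Set rFv 0) ;; scan ;;
     (Get rX rQ ;;
      Cond rFu (Cond rFv (Cond rX nop (Plus rCnt rCnt rOne ;; Put rQ rFlag)) nop) nop ;;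
      Plus rQ rQ rOne)"

definition pass :: com where
  "pass = (Plus rP rInp rTwo ;; Plus rI rM rZero ;; Plus rQ rMark rZero ;; Set rCnt 0) ;;
     Repeat rI pass_body"

definition recolor_body :: com where
  "recolor_body = Get rX rQ ;; dist_com rX rCv ;; Cond rD nop (Put rQ rCu) ;; Plus rQ rQ rOne"

text \<open>Both colours are loaded before the loop, so overwriting the colour of \<open>v\<close>
  does not disturb later comparisons.\<close>

definition recolor :: com where
  "recolor = (Plus rCu rCol rU ;; Get rCu rCu ;; Plus rCv rCol rV ;; Get rCv rCv ;;
     Plus rK rN rZero ;; Plus rQ rCol rZero) ;; Repeat rK recolor_body"

lemmas small_defs = dist_com_def nop_def

lemma sub_add_sub_eq_0: "a - b + (b - a) = 0 \<longleftrightarrow> a = (b::nat)"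
  by auto

lemma wr_scan: "wr scan = {rP, rLen, rFu, rFv, rX, rD, rE}"
  by (auto simp: scan_def scan_body_def small_defs)

lemma wr_pass: "wr pass = {rP, rI, rQ, rCnt, rLen, rFu, rFv, rX, rD, rE}"
  by (auto simp: pass_def pass_body_def wr_scan small_defs)

lemma wr_recolor: "wr recolor = {rQ, rX, rD, rE, rCu, rCv, rK}"
  by (auto simp: recolor_def recolor_body_def small_defs)

lemma wf_scan: "wf_com scan"
  by (simp add: scan_def scan_body_def small_defs)

lemma wf_pass: "wf_com pass"
  by (simp add: pass_def pass_body_def wf_scan wr_scan small_defs)

lemma wf_recolor: "wf_com recolor"
  by (simp add: recolor_def recolor_body_def small_defs)

text \<open>After \<open>k\<close> rounds the two flags record membership in the first
  \<open>k\<close> words.\<close>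

lemma scan_spec:
  assumes "seg (snd st) (fst st rP) xs" "fst st rOne = 1" "fst st rLen = length xs"
    "fst st rFu = 0" "fst st rFv = 0"
  shows "snd (sem scan st) = snd st \<and> fst (sem scan st) rP = fst st rP + length xs \<and>
    fst (sem scan st) rFu = of_bool (fst st rU \<in> set xs) \<and>
    fst (sem scan st) rFv = of_bool (fst st rV \<in> set xs) \<and>
    tm scan st \<le> 1 + length xs * 20"
proof -
  define I where "I k st' \<longleftrightarrow> snd st' = snd st \<and> fst st' rP = fst st rP + k \<and>
    fst st' rFu = of_bool (fst st rU \<in> set (take k xs)) \<and>
    fst st' rFv = of_bool (fst st rV \<in> set (take k xs))" for k st'
  have "I (fst st rLen) (sem (Repeat rLen scan_body) st) \<and>
      tm (Repeat rLen scan_body) st \<le> 1 + fst st rLen * (16 + 4)"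
  proof (rule Repeat_rule)
    show "wf_com (Repeat rLen scan_body)" by (simp add: scan_body_def small_defs)
    show "I 0 st" using assms by (simp add: I_def)
    fix k st'
    assume k: "k < fst st rLen" and I: "I k st'"
      and fr: "\<And>x. x \<notin> wr scan_body \<Longrightarrow> x \<noteq> rLen \<Longrightarrow> fst st' x = fst st x"
    have [simp]: "fst st' rOne = 1" "fst st' rU = fst st rU" "fst st' rV = fst st rV"
      using fr[of rOne] fr[of rU] fr[of rV] assms by (auto simp: scan_body_def small_defs)
    have [simp]: "snd st (fst st rP + k) = xs ! k" using assms k by (simp add: seg_def)
    have [simp]: "take (Suc k) xs = take k xs @ [xs ! k]"
      using k assms by (simp add: take_Suc_conv_app_nth)
    show "I (Suc k) (decr rLen (sem scan_body st')) \<and> tm scan_body st' \<le> 16"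
      using I by (auto simp: I_def scan_body_def small_defs decr_def sub_add_sub_eq_0)
  qed
  then show ?thesis using assms by (simp add: I_def scan_def del: sem.simps tm.simps)
qed

definition blocks :: "nat set list \<Rightarrow> nat list" where
  "blocks Es = concat (map (\<lambda>e. length (sorted_list_of_set e) # sorted_list_of_set e) Es)"

lemma blocks_append: "blocks (xs @ ys) = blocks xs @ blocks ys"
  by (simp add: blocks_def)

lemma seg_blocks_nth:
  assumes "seg h p (blocks Es)" "k < length Es"
  defines "xs \<equiv> sorted_list_of_set (Es ! k)"
  shows "seg h (p + length (blocks (take k Es))) (length xs # xs)"
    and "length (blocks (take (Suc k) Es)) = length (blocks (take k Es)) + Suc (length xs)"
    and "length xs < length (blocks Es)"
proof -
  have *: "blocks Es = blocks (take k Es) @ (length xs # xs) @ blocks (drop (Suc k) Es)"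
    unfolding xs_def by (subst id_take_nth_drop[OF assms(2)])
      (simp only: blocks_append, simp add: blocks_def)
  show "seg h (p + length (blocks (take k Es))) (length xs # xs)"
    using assms(1) unfolding * seg_append by blast
  show "length (blocks (take (Suc k) Es)) = length (blocks (take k Es)) + Suc (length xs)"
    using assms(2) by (simp add: take_Suc_conv_app_nth blocks_def xs_def)
  show "length xs < length (blocks Es)" unfolding * by simp
qed

lemma length_blocks_take_le: "length (blocks (take k Es)) \<le> length (blocks Es)"
  by (metis append_take_drop_id blocks_append le_add1 length_append)

definition unmarked_hit :: "nat set list \<Rightarrow> nat \<Rightarrow> nat \<Rightarrow> (nat \<Rightarrow> nat) \<Rightarrow> nat \<Rightarrow> nat \<Rightarrow> bool" where
  "unmarked_hit Es u v h b i \<longleftrightarrow> u \<in> Es ! i \<and> v \<in> Es ! i \<and> h (b + i) = 0"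

text \<open>
  \<open>pass\<close> writes the flag into the mark of every hyperedge it counts. With flag \<open>0\<close> it therefore
  only counts, and with flag \<open>1\<close> it also marks.
\<close>

lemma pass_spec:
  assumes seg: "seg (snd st) (fst st rInp + 2) (blocks Es)" and fin: "\<forall>e\<in>set Es. finite e"
    and regs: "fst st rOne = 1" "fst st rTwo = 2" "fst st rZero = 0" "fst st rM = length Es"
    and above: "fst st rInp + 2 + length (blocks Es) \<le> fst st rMark"
    and N: "length (blocks Es) \<le> N"
  defines "H \<equiv> unmarked_hit Es (fst st rU) (fst st rV) (snd st) (fst st rMark)"
  shows "fst (sem pass st) rP = fst st rInp + 2 + length (blocks Es) \<and>
    fst (sem pass st) rCnt = card {i. i < length Es \<and> H i} \<and>
    snd (sem pass st) = (\<lambda>a. if \<exists>i<length Es. a = fst st rMark + i \<and> H i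
      then fst st rFlag else snd st a) \<and>
    tm pass st \<le> 5 + length Es * (24 + N * 20)"
proof -
  define st0 where "st0 =
    sem (Plus rP rInp rTwo ;; Plus rI rM rZero ;; Plus rQ rMark rZero ;; Set rCnt 0) st"
  have st0: "snd st0 = snd st" "fst st0 rP = fst st rInp + 2" "fst st0 rI = length Es"
    "fst st0 rQ = fst st rMark" "fst st0 rCnt = 0" "fst st0 rOne = 1"
    "fst st0 rU = fst st rU" "fst st0 rV = fst st rV" "fst st0 rFlag = fst st rFlag"
    using regs by (simp_all add: st0_def)
  define I where "I k st' \<longleftrightarrow> fst st' rP = fst st rInp + 2 + length (blocks (take k Es)) \<and>
    fst st' rQ = fst st rMark + k \<and> fst st' rCnt = card {i. i < k \<and> H i} \<and>
    snd st' = (\<lambda>a. if \<exists>i<k. a = fst st rMark + i \<and> H i then fst st rFlag else snd st a)"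
    for k st'
  have "I (fst st0 rI) (sem (Repeat rI pass_body) st0) \<and>
      tm (Repeat rI pass_body) st0 \<le> 1 + fst st0 rI * ((N * 20 + 20) + 4)"
  proof (rule Repeat_rule)
    show "wf_com (Repeat rI pass_body)"
      by (simp add: pass_body_def scan_def scan_body_def small_defs)
    show "I 0 st0" using st0 by (simp add: I_def blocks_def)
    fix k st'
    assume k: "k < fst st0 rI" and I: "I k st'"
      and fr: "\<And>x. x \<notin> wr pass_body \<Longrightarrow> x \<noteq> rI \<Longrightarrow> fst st' x = fst st0 x"
    have kE: "k < length Es" using k st0 by simp
    have c: "fst st' rOne = 1" "fst st' rU = fst st rU" "fst st' rV = fst st rV"
      "fst st' rFlag = fst st rFlag"
      using fr[of rOne] fr[of rU] fr[of rV] fr[of rFlag] st0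
      by (auto simp: pass_body_def scan_def scan_body_def small_defs)
    define xs where "xs = sorted_list_of_set (Es ! k)"
    have set_xs: "set xs = Es ! k" using fin kE by (simp add: xs_def)
    define p where "p = fst st rInp + 2 + length (blocks (take k Es))"
    note blk = seg_blocks_nth[OF seg kE, folded xs_def]
    \<comment> \<open>Marks are written only at or beyond \<open>rMark\<close>, above all blocks, so
      \<open>scan\<close> still reads the original input.\<close>
    have "snd st' a = snd st a" if "a < fst st rMark" for a
      using I that by (auto simp: I_def)
    moreover have "p + Suc (length xs) \<le> fst st rMark"
      using above blk(2) length_blocks_take_le[of "Suc k" Es] by (simp add: p_def)
    ultimately have "seg (snd st') p (length xs # xs) = seg (snd st) p (length xs # xs)"
      by (intro seg_cong) simp
    then have sg: "snd st' p = length xs" "seg (snd st') (Suc p) xs"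
      using blk(1) by (simp_all add: p_def seg_Cons)
    have Ip: "fst st' rP = p" using I by (simp add: I_def p_def)
    define st1 where "st1 = sem (Get rLen rP ;; Plus rP rP rOne ;; Set rFu 0 ;; Set rFv 0) st'"
    have st1: "snd st1 = snd st'" "fst st1 rP = Suc p" "fst st1 rLen = length xs" "fst st1 rFu = 0"
      "fst st1 rFv = 0" "fst st1 rOne = 1" "fst st1 rU = fst st rU" "fst st1 rV = fst st rV"
      "fst st1 rFlag = fst st rFlag" "fst st1 rQ = fst st' rQ" "fst st1 rCnt = fst st' rCnt"
      using c sg Ip by (simp_all add: st1_def)
    define st2 where "st2 = sem scan st1"
    have scan: "snd st2 = snd st'" "fst st2 rP = Suc p + length xs"
      "fst st2 rFu = of_bool (fst st rU \<in> Es ! k)" "fst st2 rFv = of_bool (fst st rV \<in> Es ! k)"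
      "tm scan st1 \<le> 1 + length xs * 20"
      using scan_spec[of st1 xs] st1 sg by (simp_all add: st2_def set_xs)
    have st2: "fst st2 rOne = 1" "fst st2 rFlag = fst st rFlag" "fst st2 rQ = fst st rMark + k"
      "fst st2 rCnt = card {i. i < k \<and> H i}"
      using st1 I by (simp_all add: st2_def sem_frame wr_scan I_def)
    \<comment> \<open>Earlier rounds wrote only marks of index below \<open>k\<close>.\<close>
    have mk: "snd st' (fst st rMark + k) = snd st (fst st rMark + k)"
      using I by (auto simp: I_def)
    have Hk: "H k \<longleftrightarrow> fst st2 rFu \<noteq> 0 \<and> fst st2 rFv \<noteq> 0 \<and> snd st2 (fst st2 rQ) = 0"
      using scan st2 mk by (simp add: H_def unmarked_hit_def)
    have set_eq: "{i. i < Suc k \<and> H i} = (if H k then insert k {i. i < k \<and> H i} else {i. i < k \<and> H i})"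
      by (auto simp: less_Suc_eq)
    have heap: "(\<lambda>a. if \<exists>i<Suc k. a = fst st rMark + i \<and> H i then fst st rFlag else snd st a) =
        (if H k then (snd st')(fst st rMark + k := fst st rFlag) else snd st')"
      using I by (auto simp: I_def less_Suc_eq fun_eq_iff)
    define tl_com where "tl_com = Get rX rQ ;;
      Cond rFu (Cond rFv (Cond rX nop (Plus rCnt rCnt rOne ;; Put rQ rFlag)) nop) nop ;;
      Plus rQ rQ rOne"
    have fin3: "I (Suc k) (decr rI (sem tl_com st2)) \<and> tm tl_com st2 \<le> 13"
    proof (cases "H k")
      case True
      then have "fst st2 rFu \<noteq> 0" "fst st2 rFv \<noteq> 0" "snd st2 (fst st2 rQ) = 0" using Hk by auto
      then show ?thesis unfolding I_def heap set_eq using True st2 scan blk(2)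
        by (simp add: tl_com_def nop_def decr_def p_def)
    next
      case False
      have "fst (decr rI (sem tl_com st2)) rP = fst st2 rP \<and>
          fst (decr rI (sem tl_com st2)) rQ = Suc (fst st2 rQ) \<and>
          fst (decr rI (sem tl_com st2)) rCnt = fst st2 rCnt \<and>
          snd (decr rI (sem tl_com st2)) = snd st2 \<and> tm tl_com st2 \<le> 13"
        using False Hk st2(1) by (auto simp: tl_com_def nop_def decr_def)
      then show ?thesis unfolding I_def heap set_eq using False st2 scan blk(2)
        by (simp add: p_def)
    qed
    have "sem pass_body st' = sem tl_com st2"
      by (simp only: pass_body_def sem.simps(6) tl_com_def st1_def st2_def)
    moreover have "tm pass_body st' = 6 + (tm scan st1 + tm tl_com st2)"
      unfolding st2_def st1_def
      by (simp only: pass_body_def tl_com_def sem.simps(6) tm.simps(6)) simp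
    moreover have "length xs * 20 \<le> N * 20" using blk(3) N by simp
    ultimately show "I (Suc k) (decr rI (sem pass_body st')) \<and> tm pass_body st' \<le> N * 20 + 20"
      using fin3 scan(5) by simp
  qed
  moreover have "sem pass st = sem (Repeat rI pass_body) st0"
    by (simp only: pass_def sem.simps(6) st0_def)
  moreover have "tm pass st = 4 + tm (Repeat rI pass_body) st0"
    unfolding st0_def by (simp only: pass_def sem.simps(6) tm.simps(6)) simp
  ultimately show ?thesis using st0 by (simp add: I_def del: sem.simps tm.simps)
qed

lemma recolor_spec:
  assumes regs: "fst st rOne = 1" "fst st rZero = 0"
  defines "C \<equiv> fst st rCol"
  defines "cu \<equiv> snd st (C + fst st rU)" and "cv \<equiv> snd st (C + fst st rV)"
  shows "snd (sem recolor st) =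
      (\<lambda>a. if C \<le> a \<and> a < C + fst st rN \<and> snd st a = cv then cu else snd st a) \<and>
    tm recolor st \<le> 11 + fst st rN * 15"
proof -
  define st0 where "st0 = sem (Plus rCu rCol rU ;; Get rCu rCu ;; Plus rCv rCol rV ;; Get rCv rCv ;;
     Plus rK rN rZero ;; Plus rQ rCol rZero) st"
  have st0: "snd st0 = snd st" "fst st0 rCu = cu" "fst st0 rCv = cv" "fst st0 rK = fst st rN"
    "fst st0 rQ = C" "fst st0 rOne = 1"
    using regs by (simp_all add: st0_def C_def cu_def cv_def)
  define I where "I k st' \<longleftrightarrow> fst st' rQ = C + k \<and>
    snd st' = (\<lambda>a. if C \<le> a \<and> a < C + k \<and> snd st a = cv then cu else snd st a)" for k st'
  have "I (fst st0 rK) (sem (Repeat rK recolor_body) st0) \<and>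
      tm (Repeat rK recolor_body) st0 \<le> 1 + fst st0 rK * (11 + 4)"
  proof (rule Repeat_rule)
    show "wf_com (Repeat rK recolor_body)"
      by (simp add: recolor_body_def small_defs)
    show "I 0 st0" using st0 by (auto simp: I_def)
    fix k st'
    assume I: "I k st'" and fr: "\<And>x. x \<notin> wr recolor_body \<Longrightarrow> x \<noteq> rK \<Longrightarrow> fst st' x = fst st0 x"
    have c: "fst st' rOne = 1" "fst st' rCu = cu" "fst st' rCv = cv"
      using fr[of rOne] fr[of rCu] fr[of rCv] st0 by (auto simp: recolor_body_def small_defs)
    have x: "snd st' (C + k) = snd st (C + k)" using I by (simp add: I_def)
    have heap: "(\<lambda>a. if C \<le> a \<and> a < C + Suc k \<and> snd st a = cv then cu else snd st a) =
        (if snd st (C + k) = cv then (snd st')(C + k := cu) else snd st')"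
      using I by (auto simp: I_def fun_eq_iff less_Suc_eq)
    show "I (Suc k) (decr rK (sem recolor_body st')) \<and> tm recolor_body st' \<le> 11"
      using I c x unfolding I_def heap
      by (auto simp: recolor_body_def small_defs decr_def sub_add_sub_eq_0)
  qed
  moreover have "sem recolor st = sem (Repeat rK recolor_body) st0"
    by (simp only: recolor_def sem.simps(6) st0_def)
  moreover have "tm recolor st = 10 + tm (Repeat rK recolor_body) st0"
    unfolding st0_def by (simp only: recolor_def sem.simps(6) tm.simps(6)) simp
  ultimately show ?thesis using st0 by (simp add: I_def del: sem.simps tm.simps)
qed

section \<open>The greedy loop\<close>

definition copy_body :: com where
  "copy_body = Get rX rQ ;; Put rD rX ;; Plus rQ rQ rOne ;; Plus rD rD rOne"

definition copy :: com where
  "copy = Repeat rK copy_body"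

definition number_body :: com where
  "number_body = Put rQ rX ;; Plus rX rX rOne ;; Plus rQ rQ rOne"

definition number :: com where
  "number = Repeat rK number_body"

text \<open>The loop counter \<open>rS\<close> of \<open>greedy\<close> serves as the threshold.\<close>

definition tree_step :: com where
  "tree_step =
     (Get rU rPt ;; Plus rPt rPt rOne ;; Get rV rPt ;; Plus rPt rPt rOne ;; Set rFlag 0) ;;
     pass ;; Minus rD rS rCnt ;; Cond rD nop (Set rFlag 1 ;; pass ;; recolor)"

definition phase :: com where
  "phase = (Plus rPt rTree rZero ;; Plus rJ rTlen rZero) ;; Repeat rJ tree_step"

definition greedy :: com where
  "greedy = Repeat rS phase"

text \<open>The prologue leaves words 0 to 30 in heap cells \<open>B - 32\<close> to
  \<open>B - 2\<close> and the others in cell 0 onwards; copying these to \<open>B - 1\<close> makes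
  the input contiguous. The length \<open>B - 32\<close> is available without division and covers
  them all.\<close>

definition prepare1 :: com where
  "prepare1 = Set rOne 1 ;; Set rZero 0 ;; Set rTwo 2 ;; Set rX 32 ;; Minus rInp rB rX ;;
     Plus rK rInp rZero ;; Set rQ 0 ;; Minus rD rB rOne"

definition prepare2 :: com where
  "prepare2 = Get rN rInp ;; Plus rP rInp rOne ;; Get rM rP ;; Plus rCol rB rB ;;
     Plus rMark rCol rB ;; Plus rK rN rZero ;; Plus rQ rCol rZero ;; Set rX 0"

definition prepare3 :: com where
  "prepare3 = Get rTlen rP ;; Plus rTree rP rOne ;; Plus rS rM rZero"

text \<open>Here \<open>pass\<close> runs with flag 0 merely to advance \<open>rP\<close> to the end
  of the hyperedge blocks, where \<open>prepare3\<close> reads the number of tree edges.\<close>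

definition prepare :: com where
  "prepare = prepare1 ;; copy ;; prepare2 ;; number ;; Set rFlag 0 ;; pass ;; prepare3"

text \<open>The output is read from registers \<open>0\<close> to \<open>n - 1\<close>. Colours of
  vertices from 32 on are copied to heap cell 0 onwards; the first 32 are left to the epilogue, for
  which \<open>finish2\<close> puts the register address of the colour table into register
  0.\<close>

definition finish1 :: com where
  "finish1 = Set rX 32 ;; Minus rK rN rX ;; Plus rQ rCol rX ;; Set rD 0"

definition finish2 :: com where
  "finish2 = Set rX 32 ;; Plus rB rCol rX"

definition finish :: com where
  "finish = finish1 ;; copy ;; finish2"

lemma wr_copy: "wr copy = {rX, rQ, rD, rK}"
  by (auto simp: copy_def copy_body_def)

lemma wr_number: "wr number = {rX, rQ, rK}"
  by (auto simp: number_def number_body_def)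

lemma wr_tree_step: "wr tree_step =
    {rU, rPt, rV, rFlag, rD, rE, rP, rI, rQ, rCnt, rLen, rFu, rFv, rX, rCu, rCv, rK}"
  by (auto simp: tree_step_def wr_pass wr_recolor nop_def)

lemma wr_phase: "wr phase = insert rJ (wr tree_step)"
  by (auto simp: phase_def wr_tree_step)

lemma wf_tree_step: "wf_com tree_step"
  by (simp add: tree_step_def wf_pass wf_recolor nop_def)

lemma wf_phase: "wf_com phase"
  by (simp add: phase_def wf_tree_step wr_tree_step)

lemma wf_greedy: "wf_com greedy"
  by (simp add: greedy_def wf_phase wr_phase wr_tree_step)

lemma wf_copy: "wf_com copy"
  by (simp add: copy_def copy_body_def)

lemma wf_number: "wf_com number"
  by (simp add: number_def number_body_def)

lemma wf_prepare: "wf_com prepare"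
  by (simp add: prepare_def prepare1_def prepare2_def prepare3_def wf_copy wf_number wf_pass)

lemma wf_finish: "wf_com finish"
  by (simp add: finish_def finish1_def finish2_def wf_copy)

lemma copy_spec:
  assumes "fst st rOne = 1"
  defines "p \<equiv> fst st rQ" and "d \<equiv> fst st rD" and "l \<equiv> fst st rK"
  assumes disj: "p + l \<le> d \<or> d + l \<le> p"
  shows "snd (sem copy st) =
      (\<lambda>a. if d \<le> a \<and> a < d + l then snd st (p + (a - d)) else snd st a) \<and>
    tm copy st \<le> 1 + l * 12"
proof -
  define I where "I k st' \<longleftrightarrow> fst st' rQ = p + k \<and> fst st' rD = d + k \<and>
    snd st' = (\<lambda>a. if d \<le> a \<and> a < d + k then snd st (p + (a - d)) else snd st a)" for k st'
  have "I (fst st rK) (sem (Repeat rK copy_body) st) \<and>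
      tm (Repeat rK copy_body) st \<le> 1 + fst st rK * (8 + 4)"
  proof (rule Repeat_rule)
    show "wf_com (Repeat rK copy_body)" by (simp add: copy_body_def)
    show "I 0 st" by (auto simp: I_def p_def d_def)
    fix k st'
    assume k: "k < fst st rK" and I: "I k st'"
      and fr: "\<And>x. x \<notin> wr copy_body \<Longrightarrow> x \<noteq> rK \<Longrightarrow> fst st' x = fst st x"
    have c: "fst st' rOne = 1" using fr[of rOne] assms by (simp add: copy_body_def)
    have x: "snd st' (p + k) = snd st (p + k)" using I disj k by (auto simp: I_def l_def)
    have heap: "(\<lambda>a. if d \<le> a \<and> a < d + Suc k then snd st (p + (a - d)) else snd st a) =
        (snd st')(d + k := snd st (p + k))"
      using I by (auto simp: I_def fun_eq_iff less_Suc_eq)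
    show "I (Suc k) (decr rK (sem copy_body st')) \<and> tm copy_body st' \<le> 8"
      using I c x unfolding I_def heap by (simp add: copy_body_def decr_def)
  qed
  then show ?thesis by (simp add: I_def copy_def l_def del: sem.simps tm.simps)
qed

lemma number_spec:
  assumes "fst st rOne = 1" "fst st rX = 0"
  defines "d \<equiv> fst st rQ" and "l \<equiv> fst st rK"
  shows "snd (sem number st) = (\<lambda>a. if d \<le> a \<and> a < d + l then a - d else snd st a) \<and>
    tm number st \<le> 1 + l * 9"
proof -
  define I where "I k st' \<longleftrightarrow> fst st' rQ = d + k \<and> fst st' rX = k \<and>
    snd st' = (\<lambda>a. if d \<le> a \<and> a < d + k then a - d else snd st a)" for k st'
  have "I (fst st rK) (sem (Repeat rK number_body) st) \<and>
      tm (Repeat rK number_body) st \<le> 1 + fst st rK * (5 + 4)"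
  proof (rule Repeat_rule)
    show "wf_com (Repeat rK number_body)" by (simp add: number_body_def)
    show "I 0 st" using assms by (auto simp: I_def)
    fix k st'
    assume I: "I k st'" and fr: "\<And>x. x \<notin> wr number_body \<Longrightarrow> x \<noteq> rK \<Longrightarrow> fst st' x = fst st x"
    have c: "fst st' rOne = 1" using fr[of rOne] assms by (simp add: number_body_def)
    have heap: "(\<lambda>a. if d \<le> a \<and> a < d + Suc k then a - d else snd st a) = (snd st')(d + k := k)"
      using I by (auto simp: I_def fun_eq_iff less_Suc_eq)
    show "I (Suc k) (decr rK (sem number_body st')) \<and> tm number_body st' \<le> 5"
      using I c unfolding I_def heap by (simp add: number_body_def decr_def)
  qed
  then show ?thesis by (simp add: I_def number_def l_def del: sem.simps tm.simps)
qed

definition pairs :: "(nat \<times> nat) list \<Rightarrow> nat list" where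
  "pairs Tl = concat (map (\<lambda>(u, v). [u, v]) Tl)"

lemma length_pairs: "length (pairs Tl) = 2 * length Tl"
  by (induction Tl) (auto simp: pairs_def)

lemma seg_pairs_nth:
  "seg h p (pairs Tl) \<Longrightarrow> j < length Tl \<Longrightarrow>
    h (p + 2 * j) = fst (Tl ! j) \<and> h (Suc (p + 2 * j)) = snd (Tl ! j)"
proof (induction Tl arbitrary: p j)
  case (Cons t Tl)
  obtain u v where t: "t = (u, v)" by fastforce
  then have h: "h p = u" "h (Suc p) = v" "seg h (Suc (Suc p)) (pairs Tl)"
    using Cons.prems(1) by (auto simp: pairs_def seg_Cons)
  show ?case
  proof (cases j)
    case 0
    then show ?thesis using h t by simp
  next
    case (Suc i)
    then show ?thesis using Cons.IH[OF h(3), of i] Cons.prems(2) by simp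
  qed
qed simp

text \<open>
  Heap layout: input at \<open>B - 32\<close> (register \<open>B\<close>), colours at \<open>2 * B\<close>, marks of hyperedges at \<open>3 * B\<close>.
\<close>

locale hosted_hypertree =
  fixes n :: nat and Es :: "nat set list" and Tl :: "(nat \<times> nat) list"
  assumes hypergraph: "hypergraph {0..<n} Es"
    and host: "host_tree {0..<n} Es (tree_edges Tl)"
begin

definition "w = enc n Es Tl"
definition "L = length w"
definition "B = 32 * L"
definition "tree_base = B - 32 + 3 + length (blocks Es)"
text \<open>With \<open>color_of\<close>, the machine's version of \<open>U\<close> and
  \<open>col\<close> in \<open>greedy_inv\<close>: mark 0 means uncovered.\<close>

definition "unhit h = {i. i < length Es \<and> h (3 * B + i) = (0::nat)}" for h :: "nat \<Rightarrow> nat"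
definition "color_of h = (\<lambda>x. h (2 * B + x))" for h :: "nat \<Rightarrow> nat"

text \<open>Kept apart from \<open>regs\<close> because \<open>prepare\<close> calls
  \<open>pass\<close> before the position of the tree edges is known.\<close>

definition base_regs :: "store \<Rightarrow> bool" where
  "base_regs st \<longleftrightarrow> fst st rInp = B - 32 \<and> fst st rN = n \<and> fst st rM = length Es \<and>
    fst st rCol = 2 * B \<and> fst st rMark = 3 * B \<and>
    fst st rOne = 1 \<and> fst st rZero = 0 \<and> fst st rTwo = 2"

definition regs :: "store \<Rightarrow> bool" where
  "regs st \<longleftrightarrow> base_regs st \<and> fst st rTlen = length Tl \<and> fst st rTree = tree_base"

definition heap_inv :: "(nat \<Rightarrow> nat) \<Rightarrow> bool" where
  "heap_inv h \<longleftrightarrow> seg h (B - 32) w \<and> greedy_inv n Es Tl (unhit h) (color_of h)"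

lemma w_eq: "w = [n, length Es] @ blocks Es @ [length Tl] @ pairs Tl"
  by (simp add: w_def enc_def blocks_def pairs_def)

lemma L_eq: "L = 3 + length (blocks Es) + 2 * length Tl"
  by (simp add: L_def w_eq length_pairs)

lemma edge_subset: "\<forall>e\<in>set Es. e \<subseteq> {0..<n}" and edge_finite: "\<forall>e\<in>set Es. finite e"
  using hypergraph by (auto simp: hypergraph_def intro: finite_subset)

lemma length_Es_le: "length Es \<le> length (blocks Es)"
  by (induction Es) (auto simp: blocks_def)

text \<open>A host tree has \<open>n - 1\<close> edges and all of them are listed in the input, so
  loops over the vertices are polynomial in the input length.\<close>

lemma n_le: "n \<le> L"
proof -
  have "tree_edges Tl = (\<lambda>(u, v). {u, v}) ` set Tl"
    by (auto simp: tree_edges_def image_def)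
  then have "card (tree_edges Tl) \<le> card (set Tl)" by (simp add: card_image_le)
  also have "\<dots> \<le> length Tl" by (rule card_length)
  finally have "n - 1 \<le> length Tl" using host by (simp add: host_tree_def is_tree_def)
  then show ?thesis by (simp add: L_eq)
qed

lemma tree_edge_neq:
  assumes "j < length Tl"
  shows "fst (Tl ! j) \<noteq> snd (Tl ! j)"
proof -
  have "(fst (Tl ! j), snd (Tl ! j)) \<in> set Tl" using assms by simp
  then have "{fst (Tl ! j), snd (Tl ! j)} \<in> tree_edges Tl" unfolding tree_edges_def by blast
  then have "card {fst (Tl ! j), snd (Tl ! j)} = 2" using host by (auto simp: host_tree_def is_tree_def)
  then show ?thesis by (auto simp: card_insert_if split: if_splits)
qed

lemma seg_w:
  assumes "seg h (B - 32) w"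
  shows "h (B - 32) = n" "h (B - 32 + 1) = length Es" "seg h (B - 32 + 2) (blocks Es)"
    "h (B - 32 + 2 + length (blocks Es)) = length Tl" "seg h tree_base (pairs Tl)"
  using assms unfolding w_eq tree_base_def
  by (auto simp: seg_Cons seg_append numeral_2_eq_2 numeral_3_eq_3)

lemma pass_at:
  assumes "base_regs st" "seg (snd st) (B - 32) w"
  defines "Q \<equiv> {i. i < length Es \<and> fst st rU \<in> Es ! i \<and> fst st rV \<in> Es ! i} \<inter> unhit (snd st)"
  shows "fst (sem pass st) rP = B - 32 + 2 + length (blocks Es)"
    "fst (sem pass st) rCnt = card Q"
    "fst st rFlag = 0 \<Longrightarrow> snd (sem pass st) = snd st"
    "fst st rFlag = 1 \<Longrightarrow> unhit (snd (sem pass st)) = unhit (snd st) - Q"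
    "\<And>a. a < 3 * B \<Longrightarrow> snd (sem pass st) a = snd st a"
    "tm pass st \<le> 49 * L ^ 2"
proof -
  define H where "H = unmarked_hit Es (fst st rU) (fst st rV) (snd st) (3 * B)"
  have "fst (sem pass st) rP = fst st rInp + 2 + length (blocks Es) \<and>
    fst (sem pass st) rCnt = card {i. i < length Es \<and> H i} \<and>
    snd (sem pass st) = (\<lambda>a. if \<exists>i<length Es. a = fst st rMark + i \<and> H i
      then fst st rFlag else snd st a) \<and>
    tm pass st \<le> 5 + length Es * (24 + L * 20)"
    using pass_spec[of st Es L] assms(1) seg_w(3)[OF assms(2)] edge_finite L_eq
    by (simp add: regs_def base_regs_def H_def B_def)
  then have pass: "fst (sem pass st) rP = B - 32 + 2 + length (blocks Es)"
    "fst (sem pass st) rCnt = card {i. i < length Es \<and> H i}"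
    "snd (sem pass st) = (\<lambda>a. if \<exists>i<length Es. a = 3 * B + i \<and> H i
      then fst st rFlag else snd st a)"
    "tm pass st \<le> 5 + length Es * (24 + L * 20)"
    using assms(1) by (simp_all add: regs_def base_regs_def)
  have Q: "{i. i < length Es \<and> H i} = Q" by (auto simp: Q_def H_def unmarked_hit_def unhit_def)
  show "fst (sem pass st) rP = B - 32 + 2 + length (blocks Es)"
    "fst (sem pass st) rCnt = card Q" using pass Q by simp_all
  show "snd (sem pass st) = snd st" if "fst st rFlag = 0"
    using that unfolding pass(3) by (auto simp: H_def unmarked_hit_def fun_eq_iff)
  show "unhit (snd (sem pass st)) = unhit (snd st) - Q" if "fst st rFlag = 1"
    using that unfolding pass(3) Q[symmetric] by (auto simp: unhit_def)
  show "snd (sem pass st) a = snd st a" if "a < 3 * B" for a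
    using that unfolding pass(3) by auto
  have "length Es * (24 + L * 20) \<le> L * (24 + L * 20)"
    using length_Es_le L_eq by (intro mult_right_mono) auto
  also have "\<dots> = 24 * L + 20 * L ^ 2" by (simp add: algebra_simps power2_eq_square)
  finally have "tm pass st \<le> 5 + 24 * L + 20 * L ^ 2" using pass(4) by linarith
  \<comment> \<open>\<open>49 = 5 + 24 + 20\<close>.\<close>
  moreover have "1 \<le> L ^ 2" "L \<le> L ^ 2" using L_eq by (simp_all add: power2_eq_square)
  ultimately show "tm pass st \<le> 49 * L ^ 2" by linarith
qed

lemma regs_base: "regs st \<Longrightarrow> base_regs st"
  by (simp add: regs_def)

lemma regs_cong:
  "(\<And>x. x \<in> {1..8} \<union> {28, 29} \<Longrightarrow> fst st' x = fst st x) \<Longrightarrow> regs st \<Longrightarrow> regs st'"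
  by (simp add: regs_def base_regs_def)

text \<open>The truncated difference \<open>rS - rCnt\<close> is 0 exactly when the count reaches
  the threshold \<open>Suc s\<close>. By \<open>max\<close> it then equals the threshold, so the
  edge has maximum coverage, \<open>greedy_inv_step\<close> applies, and afterwards the edge covers
  no unmarked hyperedge. Otherwise the heap is unchanged.\<close>

lemma tree_step_spec:
  assumes r: "regs st" and inv: "heap_inv (snd st)" and j: "j < length Tl"
    and pt: "fst st rPt = tree_base + 2 * j" and s: "fst st rS = Suc s"
    and max: "\<And>j'. j' < length Tl \<Longrightarrow> card (hits Es Tl j' \<inter> unhit (snd st)) \<le> Suc s"
  defines "st' \<equiv> sem tree_step st"
  shows "heap_inv (snd st') \<and> unhit (snd st') \<subseteq> unhit (snd st) \<and>
    card (hits Es Tl j \<inter> unhit (snd st')) \<le> s \<and>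
    fst st' rPt = tree_base + 2 * Suc j \<and> tm tree_step st \<le> 136 * L ^ 2"
proof -
  have sg: "seg (snd st) (B - 32) w" and gr: "greedy_inv n Es Tl (unhit (snd st)) (color_of (snd st))"
    using inv by (auto simp: heap_inv_def)
  define u v where "u = fst (Tl ! j)" and "v = snd (Tl ! j)"
  have uv: "snd st (tree_base + 2 * j) = u" "snd st (Suc (tree_base + 2 * j)) = v"
    using seg_pairs_nth[OF seg_w(5)[OF sg] j] by (simp_all add: u_def v_def)
  define st1 where "st1 =
    sem (Get rU rPt ;; Plus rPt rPt rOne ;; Get rV rPt ;; Plus rPt rPt rOne ;; Set rFlag 0) st"
  have st1: "snd st1 = snd st" "fst st1 rU = u" "fst st1 rV = v" "fst st1 rFlag = 0"
    "fst st1 rPt = tree_base + 2 * Suc j" "fst st1 rS = Suc s"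
    using uv pt r s by (simp_all add: st1_def regs_def base_regs_def)
  have r1: "regs st1" by (rule regs_cong[OF _ r]) (auto simp: st1_def)
  define Q where "Q = hits Es Tl j \<inter> unhit (snd st)"
  have Q: "{i. i < length Es \<and> u \<in> Es ! i \<and> v \<in> Es ! i} \<inter> unhit (snd st) = Q"
    by (simp add: Q_def hits_def u_def v_def)
  note p1 = pass_at[OF regs_base[OF r1], unfolded st1 Q, OF sg]
  define st2 where "st2 = sem (Minus rD rS rCnt) (sem pass st1)"
  have st2: "snd st2 = snd st" "fst st2 rD = Suc s - card Q" "fst st2 rPt = tree_base + 2 * Suc j"
    "fst st2 rU = u" "fst st2 rV = v"
    using p1 st1 by (simp_all add: st2_def sem_frame wr_pass)
  have r2: "regs st2" by (rule regs_cong[OF _ r1]) (auto simp: st2_def sem_frame wr_pass)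
  define c where "c = Set rFlag 1 ;; pass ;; recolor"
  have st': "st' = sem (Cond rD nop c) st2"
    by (simp only: st'_def tree_step_def sem.simps(6) st1_def st2_def c_def)
  have tm: "tm tree_step st = 9 + (tm pass st1 + (1 + tm (Cond rD nop c) st2))"
    unfolding st1_def st2_def c_def tree_step_def
    by (simp only: sem.simps(6) tm.simps(6)) simp
  have L1: "1 \<le> L ^ 2" "L \<le> L ^ 2" using L_eq by (simp_all add: power2_eq_square)
  show ?thesis
  proof (cases "card Q \<le> s")
    case True
    then have "sem (Cond rD nop c) st2 = sem nop st2" "tm (Cond rD nop c) st2 = 3"
      using st2 by (simp_all add: nop_def)
    then show ?thesis using st2 inv True tm p1(6) L1 unfolding st'
      by (simp add: nop_def Q_def)
  next
    case False
    have cQ: "card Q = Suc s" using False max[OF j] by (simp add: Q_def)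
    define st3 where "st3 = sem (Set rFlag 1) st2"
    have st3: "snd st3 = snd st" "fst st3 rFlag = 1" "fst st3 rU = u" "fst st3 rV = v"
      "fst st3 rPt = tree_base + 2 * Suc j"
      using st2 by (simp_all add: st3_def)
    have r3: "regs st3" by (rule regs_cong[OF _ r2]) (auto simp: st3_def)
    note p3 = pass_at[OF regs_base[OF r3], unfolded st3 Q, OF sg]
    define st4 where "st4 = sem pass st3"
    have st4: "fst st4 rU = u" "fst st4 rV = v" "fst st4 rPt = tree_base + 2 * Suc j"
      "unhit (snd st4) = unhit (snd st) - Q" "\<And>a. a < 3 * B \<Longrightarrow> snd st4 a = snd st a"
      using p3 st3 by (simp_all add: st4_def sem_frame wr_pass)
    have r4: "regs st4" by (rule regs_cong[OF _ r3]) (auto simp: st4_def sem_frame wr_pass)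
    have sem_c: "st' = sem recolor st4"
      using st2 cQ unfolding st' by (simp add: c_def st4_def st3_def)
    have tm_c: "tm (Cond rD nop c) st2 = 2 + (tm pass st3 + tm recolor st4)"
      using st2 cQ by (simp add: c_def st4_def st3_def)
    have rc: "snd st' = (\<lambda>a. if 2 * B \<le> a \<and> a < 2 * B + n \<and> snd st4 a = snd st4 (2 * B + v)
        then snd st4 (2 * B + u) else snd st4 a)" "tm recolor st4 \<le> 11 + n * 15"
      using recolor_spec[of st4] r4 st4 unfolding sem_c regs_def base_regs_def by auto
    have B: "L \<le> B" "n \<le> B" using n_le by (auto simp: B_def)
    have uh: "unhit (snd st') = unhit (snd st) - Q"
      unfolding st4(4)[symmetric] unfolding rc(1) using B by (auto simp: unhit_def)
    have "hits Es Tl j \<inter> unhit (snd st) \<noteq> {}" using cQ by (auto simp: Q_def)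
    then obtain i where i: "i < length Es" "u \<in> Es ! i" "v \<in> Es ! i"
      by (auto simp: hits_def u_def v_def)
    then have "Es ! i \<subseteq> {0..<n}" using edge_subset nth_mem by blast
    then have n: "u < n" "v < n" using i by auto
    have "greedy_inv n Es Tl (unhit (snd st) - hits Es Tl j) (color_of (snd st'))"
    proof (rule greedy_inv_step[OF gr edge_subset])
      show "Tl ! j = (u, v)" "u \<noteq> v" using tree_edge_neq[OF j] by (simp_all add: u_def v_def)
      show "card (hits Es Tl j' \<inter> unhit (snd st)) \<le> card (hits Es Tl j \<inter> unhit (snd st))"
        if "j' < length Tl" for j' using max[OF that] cQ by (simp add: Q_def)
      show "color_of (snd st') x = (if color_of (snd st) x = color_of (snd st) v
          then color_of (snd st) u else color_of (snd st) x)" if "x < n" for x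
        using that n B st4(5) unfolding rc(1) color_of_def by auto
    qed fact
    moreover have "unhit (snd st) - hits Es Tl j = unhit (snd st')" using uh by (auto simp: Q_def)
    moreover have "seg (snd st') (B - 32) w = seg (snd st) (B - 32) w"
      using B L_eq st4(5) unfolding rc(1) by (intro seg_cong) (auto simp: L_def B_def)
    ultimately have "heap_inv (snd st')" using sg by (simp add: heap_inv_def)
    moreover have "hits Es Tl j \<inter> unhit (snd st') = {}" using uh by (auto simp: Q_def)
    moreover have "fst st' rPt = tree_base + 2 * Suc j"
      using st4 by (simp add: sem_c sem_frame wr_recolor)
    \<comment> \<open>\<open>136 = 9 + 49 + 1 + 2 + 49 + 11 + 15\<close>, for two passes, one
      recolouring and the glue.\<close>
    moreover have "tm tree_step st \<le> 136 * L ^ 2"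
      using tm tm_c rc(2) p1(6) p3(6) n_le L1 by linarith
    ultimately show ?thesis using uh by auto
  qed
qed

text \<open>The uncovered set only shrinks, so the bound \<open>s\<close> reached at a visited tree
  edge persists, and edges still to come stay within \<open>Suc s\<close>.\<close>

lemma phase_spec:
  assumes r: "regs st" and inv: "heap_inv (snd st)" and s: "fst st rS = Suc s"
    and max: "\<And>j'. j' < length Tl \<Longrightarrow> card (hits Es Tl j' \<inter> unhit (snd st)) \<le> Suc s"
  defines "st' \<equiv> sem phase st"
  shows "heap_inv (snd st') \<and> (\<forall>j<length Tl. card (hits Es Tl j \<inter> unhit (snd st')) \<le> s) \<and>
    tm phase st \<le> 143 * L ^ 3"
proof -
  define st0 where "st0 = sem (Plus rPt rTree rZero ;; Plus rJ rTlen rZero) st"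
  have st0: "snd st0 = snd st" "fst st0 rPt = tree_base" "fst st0 rJ = length Tl" "fst st0 rS = Suc s"
    using r s by (simp_all add: st0_def regs_def base_regs_def)
  have r0: "regs st0" by (rule regs_cong[OF _ r]) (auto simp: st0_def)
  have fin: "finite (hits Es Tl j)" for j by (simp add: hits_def)
  define I where "I k st' \<longleftrightarrow> heap_inv (snd st') \<and> fst st' rPt = tree_base + 2 * k \<and>
    (\<forall>j<length Tl. card (hits Es Tl j \<inter> unhit (snd st')) \<le> Suc s) \<and>
    (\<forall>j<k. card (hits Es Tl j \<inter> unhit (snd st')) \<le> s)" for k st'
  have "I (fst st0 rJ) (sem (Repeat rJ tree_step) st0) \<and>
      tm (Repeat rJ tree_step) st0 \<le> 1 + fst st0 rJ * (136 * L ^ 2 + 4)"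
  proof (rule Repeat_rule)
    show "wf_com (Repeat rJ tree_step)" by (simp add: wf_tree_step wr_tree_step)
    show "I 0 st0" using st0 inv max by (simp add: I_def)
    fix k st1
    assume k: "k < fst st0 rJ" and I: "I k st1"
      and fr: "\<And>x. x \<notin> wr tree_step \<Longrightarrow> x \<noteq> rJ \<Longrightarrow> fst st1 x = fst st0 x"
    have r1: "regs st1" by (rule regs_cong[OF _ r0]) (auto simp: fr wr_tree_step)
    have s1: "fst st1 rS = Suc s" using fr[of rS] st0 by (simp add: wr_tree_step)
    define st2 where "st2 = sem tree_step st1"
    have ts: "heap_inv (snd st2)" "unhit (snd st2) \<subseteq> unhit (snd st1)"
      "card (hits Es Tl k \<inter> unhit (snd st2)) \<le> s" "fst st2 rPt = tree_base + 2 * Suc k"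
      "tm tree_step st1 \<le> 136 * L ^ 2"
      using tree_step_spec[OF r1 _ _ _ s1, of k] I k st0 by (simp_all add: I_def st2_def)
    have mono: "card (hits Es Tl j \<inter> unhit (snd st2)) \<le> card (hits Es Tl j \<inter> unhit (snd st1))" for j
      using ts(2) fin by (intro card_mono) auto
    have "card (hits Es Tl j \<inter> unhit (snd st2)) \<le> s" if "j < Suc k" for j
      using I ts(3) mono[of j] that unfolding I_def by (cases "j = k") (auto intro: order_trans)
    moreover have "card (hits Es Tl j \<inter> unhit (snd st2)) \<le> Suc s" if "j < length Tl" for j
      using I mono[of j] that unfolding I_def by (auto intro: order_trans)
    ultimately have "I (Suc k) (decr rJ st2)"
      using ts unfolding I_def by (simp add: decr_def)
    then show "I (Suc k) (decr rJ (sem tree_step st1)) \<and> tm tree_step st1 \<le> 136 * L ^ 2"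
      using ts by (simp add: st2_def)
  qed
  moreover have "st' = sem (Repeat rJ tree_step) st0"
    by (simp only: st'_def phase_def sem.simps(6) st0_def)
  moreover have "tm phase st = 2 + tm (Repeat rJ tree_step) st0"
    unfolding st0_def by (simp only: phase_def sem.simps(6) tm.simps(6)) simp
  moreover have "length Tl * (136 * L ^ 2 + 4) \<le> L * (136 * L ^ 2 + 4)"
    using L_eq by (intro mult_right_mono) auto
  then have "length Tl * (136 * L ^ 2 + 4) \<le> 136 * L ^ 3 + 4 * L"
    by (simp add: algebra_simps power2_eq_square power3_eq_cube)
  moreover have "3 \<le> L ^ 3" "L \<le> L ^ 3" using L_eq self_le_power[of L 3] by simp_all
  ultimately show ?thesis using st0 by (auto simp: I_def simp del: sem.simps tm.simps)
qed

text \<open>The first threshold is the number of hyperedges, a trivial bound on coverage; each phase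
  lowers the bound by one until it is 0.\<close>

lemma greedy_spec:
  assumes r: "regs st" and inv: "heap_inv (snd st)" and s: "fst st rS = length Es"
  shows "regs (sem greedy st) \<and> heap_inv (snd (sem greedy st)) \<and>
    (\<forall>j<length Tl. card (hits Es Tl j \<inter> unhit (snd (sem greedy st))) = 0) \<and>
    tm greedy st \<le> 148 * L ^ 4"
proof -
  define I where "I k st' \<longleftrightarrow> heap_inv (snd st') \<and>
    (\<forall>j<length Tl. card (hits Es Tl j \<inter> unhit (snd st')) \<le> length Es - k)" for k and st' :: store
  have "card (hits Es Tl j \<inter> unhit (snd st)) \<le> length Es" for j
    using card_mono[of "{..<length Es}" "hits Es Tl j \<inter> unhit (snd st)"] by (auto simp: hits_def)
  then have I0: "I 0 st" using inv by (simp add: I_def)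
  have "I (fst st rS) (sem (Repeat rS phase) st) \<and>
      tm (Repeat rS phase) st \<le> 1 + fst st rS * (143 * L ^ 3 + 4)"
  proof (rule Repeat_rule)
    show "I 0 st" by (rule I0)
    show "wf_com (Repeat rS phase)" using wf_greedy by (simp add: greedy_def)
    fix k st1
    assume k: "k < fst st rS" and I: "I k st1" and s1: "fst st1 rS = fst st rS - k"
      and fr: "\<And>x. x \<notin> wr phase \<Longrightarrow> x \<noteq> rS \<Longrightarrow> fst st1 x = fst st x"
    have r1: "regs st1" by (rule regs_cong[OF _ r]) (auto simp: fr wr_phase wr_tree_step)
    have eq: "length Es - k = Suc (length Es - Suc k)" using k s by simp
    show "I (Suc k) (decr rS (sem phase st1)) \<and> tm phase st1 \<le> 143 * L ^ 3"
      using phase_spec[OF r1, of "length Es - Suc k"] I s1 s eq by (simp add: I_def decr_def)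
  qed
  moreover have "regs (sem greedy st)"
    by (rule regs_cong[OF _ r], subst sem_frame) (auto simp: greedy_def wr_phase wr_tree_step)
  moreover have "length Es * (143 * L ^ 3 + 4) \<le> L * (143 * L ^ 3 + 4)"
    using L_eq length_Es_le by (intro mult_right_mono) auto
  then have "length Es * (143 * L ^ 3 + 4) \<le> 143 * L ^ 4 + 4 * L"
    by (simp add: algebra_simps eval_nat_numeral)
  moreover have "1 \<le> L ^ 4" "L \<le> L ^ 4" using L_eq self_le_power[of L 4] by simp_all
  ultimately show ?thesis using s by (auto simp: I_def greedy_def simp del: sem.simps tm.simps)
qed

end

section \<open>The complete program\<close>

text \<open>
  The input occupies registers \<open>0, \<dots>, L\<close>, so no register is free at the start. Doubling register
  \<open>0\<close> five times gives an address \<open>B = 32 L\<close> beyond both the input and the scalars; input word \<open>0\<close>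
  is stored there, which frees register \<open>1\<close> as an address register for moving the words in
  registers \<open>2, \<dots>, 31\<close>. Conversely, the epilogue fills the scalars with colours in place by
  \<open>Load i i\<close>.
\<close>

definition prologue :: "instr list" where
  "prologue = replicate 5 (Add 0 0 0) @ [Store 0 1] @
     concat (map (\<lambda>i. [Const 1 (Suc i), Add 1 0 1, Store 1 (i + 2)]) [0..<30])"

definition epilogue :: "instr list" where
  "epilogue = concat (map (\<lambda>i. [Const (Suc i) (Suc i), Add (Suc i) (Suc i) 0]) [0..<31]) @
     map (\<lambda>i. Load i i) [0..<32]"

definition main_com :: com where
  "main_com = prepare ;; greedy ;; finish"

definition program :: "instr list" where
  "program = prologue @ comp main_com 96 @ epilogue"

lemma length_concat_upt: "length (concat (map (\<lambda>i. [f i, g i, h i]) [0..<k])) = 3 * k"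
  "length (concat (map (\<lambda>i. [f i, g i]) [0..<k])) = 2 * k"
  by (induction k) auto

lemma save_run:
  assumes "code_at P pc (concat (map (\<lambda>i. [Const 1 (Suc i), Add 1 0 1, Store 1 (i + 2)]) [0..<k]))"
    and "32 \<le> R 0" "k \<le> 30"
  shows "\<exists>R'. run P (3 * k) (pc, R) = (pc + 3 * k, R') \<and>
    (\<forall>i<k. R' (R 0 + Suc i) = R (i + 2)) \<and>
    (\<forall>a. a \<noteq> 1 \<longrightarrow> a \<le> R 0 \<or> R 0 + k < a \<longrightarrow> R' a = R a)"
  using assms(1,3)
proof (induction k)
  case 0
  then show ?case by (auto simp: run_0)
next
  case (Suc k)
  then have ca: "code_at P pc (concat (map (\<lambda>i. [Const 1 (Suc i), Add 1 0 1, Store 1 (i + 2)]) [0..<k]))"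
    "code_at P (pc + 3 * k) [Const 1 (Suc k), Add 1 0 1, Store 1 (k + 2)]"
    by (simp_all add: code_at_append length_concat_upt)
  from Suc.IH[OF ca(1)] Suc.prems obtain R1 where R1: "run P (3 * k) (pc, R) = (pc + 3 * k, R1)"
    "\<And>i. i < k \<Longrightarrow> R1 (R 0 + Suc i) = R (i + 2)"
    "\<And>a. a \<noteq> 1 \<Longrightarrow> a \<le> R 0 \<or> R 0 + k < a \<Longrightarrow> R1 a = R a" by auto
  define R2 where "R2 = R1(1 := R 0 + Suc k, R 0 + Suc k := R (k + 2))"
  \<comment> \<open>The sources are registers 2 to 31, whereas all stores so far went above
    \<open>R 0\<close>, which is at least 32; so the word is still the original one.\<close>
  have "R1 0 = R 0" "R1 (k + 2) = R (k + 2)" using R1(3) assms(2) Suc.prems by auto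
  then have s: "run P 3 (pc + 3 * k, R1) = (pc + 3 * k + 3, R2)"
    using ca(2) by (simp add: run_simps numeral_3_eq_3 R2_def)
  have "3 * Suc k = 3 * k + 3" by simp
  then have "run P (3 * Suc k) (pc, R) = (pc + 3 * Suc k, R2)"
    using s R1(1) by (simp only: run_add) simp
  moreover have "\<forall>i<Suc k. R2 (R 0 + Suc i) = R (i + 2)"
    using R1(2) assms(2) by (auto simp: R2_def less_Suc_eq)
  moreover have "\<forall>a. a \<noteq> 1 \<longrightarrow> a \<le> R 0 \<or> R 0 + Suc k < a \<longrightarrow> R2 a = R a"
    using R1(3) by (auto simp: R2_def)
  ultimately show ?case by blast
qed

lemma prologue_run:
  assumes "code_at P 0 prologue" "3 \<le> R 0"
  shows "\<exists>R'. run P 96 (0, R) = (96, R') \<and> R' 0 = 32 * R 0 \<and>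
    (\<forall>i<31. R' (32 * R 0 + i) = R (Suc i)) \<and>
    (\<forall>a. 32 \<le> a \<longrightarrow> a < 32 * R 0 \<or> 32 * R 0 + 31 \<le> a \<longrightarrow> R' a = R a)"
proof -
  define R1 where "R1 = R(0 := 32 * R 0, 32 * R 0 := R 1)"
  have ca: "code_at P 0 (replicate 5 (Add 0 0 0) @ [Store 0 1])"
    "code_at P 6 (concat (map (\<lambda>i. [Const 1 (Suc i), Add 1 0 1, Store 1 (i + 2)]) [0..<30]))"
    using assms(1) unfolding prologue_def
    by (simp_all only: code_at_append length_replicate length_append) simp_all
  have 1: "run P 6 (0, R) = (6, R1)"
    using ca(1) assms(2) by (auto simp: run_simps eval_nat_numeral R1_def fun_eq_iff)
  have R10: "R1 0 = 32 * R 0" using assms(2) by (simp add: R1_def)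
  obtain R2 where R2: "run P 90 (6, R1) = (96, R2)"
    "\<And>i. i < 30 \<Longrightarrow> R2 (32 * R 0 + Suc i) = R1 (i + 2)"
    "\<And>a. a \<noteq> 1 \<Longrightarrow> a \<le> 32 * R 0 \<or> 32 * R 0 + 30 < a \<Longrightarrow> R2 a = R1 a"
    using save_run[OF ca(2), of R1] assms(2) R10 by auto
  have "run P (6 + 90) (0, R) = (96, R2)" by (simp only: run_add 1 R2)
  moreover have "R2 0 = 32 * R 0" using R2(3)[of 0] R10 by simp
  moreover have "R2 (32 * R 0 + i) = R (Suc i)" if "i < 31" for i
  proof (cases i)
    case 0
    then show ?thesis using R2(3)[of "32 * R 0"] assms(2) by (simp add: R1_def)
  next
    case (Suc k)
    then show ?thesis using R2(2)[of k] that assms(2) by (simp add: R1_def)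
  qed
  moreover have "R2 a = R a" if "32 \<le> a" "a < 32 * R 0 \<or> 32 * R 0 + 31 \<le> a" for a
    using R2(3)[of a] that by (auto simp: R1_def)
  ultimately show ?thesis by auto
qed

lemma point_run:
  assumes "code_at P pc (concat (map (\<lambda>i. [Const (Suc i) (Suc i), Add (Suc i) (Suc i) 0]) [0..<k]))"
  shows "run P (2 * k) (pc, R) =
    (pc + 2 * k, \<lambda>a. if 1 \<le> a \<and> a \<le> k then R 0 + a else R a)"
  using assms
proof (induction k)
  case 0
  then show ?case by (auto simp: run_0)
next
  case (Suc k)
  then have ca: "code_at P pc (concat (map (\<lambda>i. [Const (Suc i) (Suc i), Add (Suc i) (Suc i) 0]) [0..<k]))"
    "code_at P (pc + 2 * k) [Const (Suc k) (Suc k), Add (Suc k) (Suc k) 0]"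
    by (simp_all add: code_at_append length_concat_upt)
  have e: "2 * Suc k = 2 * k + 2" by simp
  show ?case unfolding e run_add Suc.IH[OF ca(1)]
    using ca(2) by (auto simp: run_simps numeral_2_eq_2 fun_eq_iff)
qed

text \<open>Every address read is at least \<open>k\<close>, hence never a register that has already
  been overwritten.\<close>

lemma load_run:
  assumes "code_at P pc (map (\<lambda>i. Load i i) [0..<k])" "\<And>i. i < k \<Longrightarrow> k \<le> R i"
  shows "run P k (pc, R) = (pc + k, \<lambda>a. if a < k then R (R a) else R a)"
proof -
  have "j \<le> k \<Longrightarrow> run P j (pc, R) = (pc + j, \<lambda>a. if a < j then R (R a) else R a)" for j
  proof (induction j)
    case 0
    then show ?case by (simp add: run_0)
  next
    case (Suc j)
    have "[0..<k] = [0..<j] @ j # [Suc j..<k]"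
      using Suc.prems by (metis Suc_le_eq upt_conv_Cons upt_add_eq_append zero_le le_add_diff_inverse less_imp_le_nat)
    then have "pc + j < length P" "P ! (pc + j) = Load j j"
      using assms(1) by (simp_all add: code_at_append code_at_Cons)
    moreover have "\<not> R j < j" using assms(2)[of j] Suc.prems by simp
    moreover have "run P (j + 1) (pc, R) = run P 1 (pc + j, \<lambda>a. if a < j then R (R a) else R a)"
      using Suc by (simp only: run_add)
    ultimately show ?case by (auto simp: run_simps fun_eq_iff less_Suc_eq)
  qed
  then show ?thesis by simp
qed

text \<open>Register 0 already holds its own source address, so pointers are set up only in
  registers 1 to 31 before all 32 are dereferenced in place.\<close>

lemma epilogue_run:
  assumes "code_at P pc epilogue" "32 \<le> R 0"
  shows "run P 94 (pc, R) = (pc + 94, \<lambda>a. if a < 32 then R (R 0 + a) else R a)"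
proof -
  let ?R = "\<lambda>a. if 1 \<le> a \<and> a \<le> 31 then R 0 + a else R a"
  have ca: "code_at P pc (concat (map (\<lambda>i. [Const (Suc i) (Suc i), Add (Suc i) (Suc i) 0]) [0..<31]))"
    "code_at P (pc + 62) (map (\<lambda>i. Load i i) [0..<32])"
    using assms(1) unfolding epilogue_def code_at_append length_concat_upt by simp_all
  have "run P (62 + 32) (pc, R) = run P 32 (pc + 62, ?R)"
    using point_run[OF ca(1), of R] by (simp only: run_add) simp
  also have "\<dots> = (pc + 62 + 32, \<lambda>a. if a < 32 then ?R (?R a) else ?R a)"
    using assms(2) by (intro load_run[OF ca(2)]) (auto simp: not_le)
  also have "(\<lambda>a. if a < 32 then ?R (?R a) else ?R a) = (\<lambda>a. if a < 32 then R (R 0 + a) else R a)"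
    using assms(2) by (auto simp: fun_eq_iff Suc_le_eq)
  finally show ?thesis by simp
qed

section \<open>Set-up, output and total running time\<close>

context hosted_hypertree
begin

text \<open>The hypotheses are the state left by the prologue: words from 31 on at the bottom of the
  heap, the first 31 at \<open>B - 32\<close>, zeros from \<open>B\<close> on.\<close>

lemma prepare_spec:
  assumes rB: "fst st rB = B"
    and low: "\<And>a. a < B - 32 \<Longrightarrow> snd st a = (if a + 31 < L then w ! (a + 31) else 0)"
    and saved: "\<And>i. i < 31 \<Longrightarrow> i < L \<Longrightarrow> snd st (B - 32 + i) = w ! i"
    and zero: "\<And>a. B \<le> a \<Longrightarrow> snd st a = 0"
  shows "regs (sem prepare st) \<and> heap_inv (snd (sem prepare st)) \<and>
    fst (sem prepare st) rS = length Es \<and> tm prepare st \<le> 470 * L ^ 2"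
proof -
  have L: "3 \<le> L" using L_eq by simp
  have B96: "96 \<le> B" "B = 32 * L" using L by (simp_all add: B_def)
  have nm: "n \<le> L" "length Es \<le> L" using n_le length_Es_le L_eq by simp_all
  define st1 where "st1 = sem prepare1 st"
  have st1: "snd st1 = snd st" "fst st1 rOne = 1" "fst st1 rZero = 0" "fst st1 rTwo = 2"
    "fst st1 rInp = B - 32" "fst st1 rK = B - 32" "fst st1 rQ = 0" "fst st1 rD = B - 1" "fst st1 rB = B"
    using rB by (simp_all add: st1_def prepare1_def)
  define st2 where "st2 = sem copy st1"
  have cp: "snd st2 = (\<lambda>a. if B - 1 \<le> a \<and> a < B - 1 + (B - 32) then snd st (a - (B - 1)) else snd st a)"
    "tm copy st1 \<le> 1 + (B - 32) * 12"
    using copy_spec[of st1, unfolded st1] B96 by (auto simp: st2_def fun_eq_iff)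
  have st2: "fst st2 rOne = 1" "fst st2 rZero = 0" "fst st2 rTwo = 2"
    "fst st2 rInp = B - 32" "fst st2 rB = B"
    using st1 by (simp_all add: st2_def sem_frame wr_copy)
  have sg2: "seg (snd st2) (B - 32) w"
    unfolding seg_def
  proof (intro allI impI)
    fix k assume "k < length w"
    then have k: "k < L" by (simp add: L_def)
    show "snd st2 (B - 32 + k) = w ! k"
    proof (cases "k < 31")
      case True
      then have "\<not> B - 1 \<le> B - 32 + k" using B96 by simp
      then show ?thesis using saved[OF True k] by (simp add: cp)
    next
      case False
      then have "B - 1 \<le> B - 32 + k" "B - 32 + k < B - 1 + (B - 32)" "B - 32 + k - (B - 1) = k - 31"
        "k - 31 < B - 32" using B96 k L by auto
      then show ?thesis using low[of "k - 31"] False k by (simp add: cp)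
    qed
  qed
  \<comment> \<open>The copied block ends below \<open>2 * B\<close>, so all marks start at 0,
    meaning uncovered.\<close>
  have z2: "snd st2 a = 0" if "2 * B \<le> a" for a
  proof -
    have "\<not> a < B - 1 + (B - 32)" using that B96 by linarith
    then show ?thesis using that zero[of a] by (simp add: cp)
  qed
  define st3 where "st3 = sem prepare2 st2"
  have st3: "snd st3 = snd st2" "fst st3 rOne = 1" "fst st3 rX = 0" "fst st3 rQ = 2 * B" "fst st3 rK = n"
    "fst st3 rZero = 0" "fst st3 rTwo = 2" "fst st3 rInp = B - 32" "fst st3 rN = n"
    "fst st3 rM = length Es" "fst st3 rCol = 2 * B" "fst st3 rMark = 3 * B"
    using st2 seg_w(1,2)[OF sg2] by (simp_all add: st3_def prepare2_def)
  define st4 where "st4 = sem (Set rFlag 0) (sem number st3)"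
  have h4: "snd st4 = (\<lambda>a. if 2 * B \<le> a \<and> a < 2 * B + n then a - 2 * B else snd st2 a)"
    and tn: "tm number st3 \<le> 1 + n * 9"
    using number_spec[of st3, unfolded st3] by (auto simp: st4_def)
  have r4: "base_regs st4" "fst st4 rFlag = 0"
    using st3 by (simp_all add: base_regs_def st4_def sem_frame wr_number)
  have "seg (snd st4) (B - 32) w = seg (snd st2) (B - 32) w"
    using B96 L by (intro seg_cong) (auto simp: h4 L_def)
  then have sg4: "seg (snd st4) (B - 32) w" using sg2 by simp
  have "unhit (snd st4) = {..<length Es}"
    using z2 nm B96 by (auto simp: unhit_def h4)
  moreover have "greedy_inv n Es Tl {..<length Es} (color_of (snd st4))"
    by (rule greedy_inv_init) (simp add: color_of_def h4)
  ultimately have hi: "heap_inv (snd st4)" using sg4 by (simp add: heap_inv_def)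
  note ps = pass_at[OF r4(1) sg4]
  define st5 where "st5 = sem pass st4"
  have st5: "snd st5 = snd st4" "fst st5 rP = B - 32 + 2 + length (blocks Es)"
    using ps(1,3) r4(2) by (simp_all add: st5_def)
  have r5: "base_regs st5" using r4(1) by (simp add: base_regs_def st5_def sem_frame wr_pass)
  have eq: "sem prepare st = sem prepare3 st5"
    by (simp only: prepare_def sem.simps(6) st5_def st4_def st3_def st2_def st1_def)
  have tm: "tm prepare st = 8 + (tm copy st1 + (12 + (tm number st3 + (1 + (tm pass st4 + 5)))))"
    unfolding st4_def st3_def st2_def st1_def prepare_def
    by (simp only: sem.simps(6) tm.simps(6)) (simp add: prepare1_def prepare2_def prepare3_def)
  have "regs (sem prepare3 st5) \<and> snd (sem prepare3 st5) = snd st4 \<and>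
      fst (sem prepare3 st5) rS = length Es"
    using r5 st5 seg_w(4)[OF sg4] B96
    by (simp add: regs_def base_regs_def prepare3_def tree_base_def)
  moreover have "1 \<le> L ^ 2" "L \<le> L ^ 2" using L by (simp_all add: power2_eq_square)
  \<comment> \<open>Most of the 470 is the copy: 12 steps for each of fewer than
    \<open>32 * L\<close> cells.\<close>
  then have "tm prepare st \<le> 470 * L ^ 2" using tm cp(2) tn ps(6) nm B96 by linarith
  ultimately show ?thesis using hi eq by simp
qed

lemma finish_spec:
  assumes r: "regs st"
  defines "st' \<equiv> sem finish st"
  shows "fst st' rB = 2 * B + 32 \<and> (\<forall>i<n. snd st' (2 * B + i) = color_of (snd st) i) \<and>
    (\<forall>i<n. 32 \<le> i \<longrightarrow> snd st' (i - 32) = color_of (snd st) i) \<and> tm finish st \<le> 7 + 12 * L"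
proof -
  define st1 where "st1 = sem finish1 st"
  have st1: "snd st1 = snd st" "fst st1 rOne = 1" "fst st1 rK = n - 32" "fst st1 rQ = 2 * B + 32"
    "fst st1 rD = 0" "fst st1 rCol = 2 * B"
    using r by (simp_all add: st1_def finish1_def regs_def base_regs_def)
  have nB: "n \<le> B" using n_le by (simp add: B_def)
  define st2 where "st2 = sem copy st1"
  have cp: "snd st2 = (\<lambda>a. if a < n - 32 then snd st (2 * B + 32 + a) else snd st a)"
    "tm copy st1 \<le> 1 + (n - 32) * 12"
    using copy_spec[of st1, unfolded st1] nB by (auto simp: st2_def fun_eq_iff)
  have "fst st2 rCol = 2 * B" using st1 by (simp add: st2_def sem_frame wr_copy)
  then have "fst st' rB = 2 * B + 32" "snd st' = snd st2"
    unfolding st'_def finish_def sem.simps(6) st2_def st1_def by (simp_all add: finish2_def)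
  moreover have "tm finish st = 4 + (tm copy st1 + 2)"
    unfolding st1_def finish_def
    by (simp only: sem.simps(6) tm.simps(6)) (simp add: finish1_def finish2_def)
  ultimately show ?thesis using cp nB n_le by (auto simp: color_of_def)
qed

lemma program_run:
  "\<exists>t R. t \<le> 1200 * (L + 1) ^ 4 \<and> run program t (init w) = (length program, R) \<and>
     C_coloring Es R \<and>
     real (n - card (R ` {0..<n})) \<le> (1 + ln (real (length Es))) * real (dec {0..<n} Es)"
proof -
  have L: "3 \<le> L" using L_eq by simp
  have lp: "length prologue = 96" by (simp add: prologue_def length_concat_upt)
  have le: "length epilogue = 94" by (simp add: epilogue_def length_concat_upt)
  have "code_at program 0 program" unfolding code_at_def by (intro exI[of _ "[]"]) simp
  then have ca: "code_at program 0 prologue" "code_at program 96 (comp main_com 96)"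
    "code_at program (96 + clen main_com) epilogue"
    unfolding program_def by (simp_all only: code_at_append lp length_comp add_0 append_assoc)
  define R0 where "R0 = snd (init w)"
  have R0: "init w = (0, R0)" "R0 0 = L"
    "\<And>a. R0 (Suc a) = (if a < L then w ! a else 0)"
    by (auto simp: R0_def init_def L_def)
  obtain R1 where R1: "run program 96 (0, R0) = (96, R1)" "R1 0 = B"
    "\<And>i. i < 31 \<Longrightarrow> R1 (B + i) = R0 (Suc i)"
    "\<And>a. 32 \<le> a \<Longrightarrow> a < B \<or> B + 31 \<le> a \<Longrightarrow> R1 a = R0 a"
    using prologue_run[OF ca(1), of R0] R0(2) L unfolding B_def by auto
  define st where "st = (R1, \<lambda>a. R1 (32 + a))"
  have rep: "repr st R1" by (simp add: repr_def st_def)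
  have B96: "96 \<le> B" "B = 32 * L" using L by (simp_all add: B_def)
  define st1 where "st1 = sem prepare st"
  have prep: "regs st1" "heap_inv (snd st1)" "fst st1 rS = length Es" "tm prepare st \<le> 470 * L ^ 2"
  proof -
    have "regs (sem prepare st) \<and> heap_inv (snd (sem prepare st)) \<and>
      fst (sem prepare st) rS = length Es \<and> tm prepare st \<le> 470 * L ^ 2"
    proof (rule prepare_spec)
      show "fst st rB = B" using R1 by (simp add: st_def)
      show "snd st a = (if a + 31 < L then w ! (a + 31) else 0)" if "a < B - 32" for a
      proof -
        have "R1 (Suc (a + 31)) = R0 (Suc (a + 31))" using that by (intro R1(4)) auto
        then show ?thesis unfolding R0(3) by (simp add: st_def add.commute)
      qed
      show "snd st (B - 32 + i) = w ! i" if "i < 31" "i < L" for i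
        using R1(3)[OF that(1)] R0(3)[of i] that B96 by (simp add: st_def)
      show "snd st a = 0" if "B \<le> a" for a
        using R1(4)[of "32 + a"] R0(3)[of "31 + a"] that B96 by (simp add: st_def)
    qed
    then show "regs st1" "heap_inv (snd st1)" "fst st1 rS = length Es" "tm prepare st \<le> 470 * L ^ 2"
      by (simp_all add: st1_def)
  qed
  define st2 where "st2 = sem greedy st1"
  have gr: "regs st2" "heap_inv (snd st2)"
    "\<And>j. j < length Tl \<Longrightarrow> card (hits Es Tl j \<inter> unhit (snd st2)) = 0" "tm greedy st1 \<le> 148 * L ^ 4"
    using greedy_spec[OF prep(1-3)] by (simp_all add: st2_def)
  define st3 where "st3 = sem finish st2"
  have fi: "fst st3 rB = 2 * B + 32" "\<And>i. i < n \<Longrightarrow> snd st3 (2 * B + i) = color_of (snd st2) i"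
    "\<And>i. i < n \<Longrightarrow> 32 \<le> i \<Longrightarrow> snd st3 (i - 32) = color_of (snd st2) i" "tm finish st2 \<le> 7 + 12 * L"
    using finish_spec[OF gr(1)] by (simp_all add: st3_def)
  have sem: "sem main_com st = st3" "tm main_com st = tm prepare st + (tm greedy st1 + tm finish st2)"
    by (simp_all add: main_com_def st1_def st2_def st3_def)
  have "wf_com main_com" by (simp add: main_com_def wf_prepare wf_greedy wf_finish)
  from comp_correct[OF this ca(2) rep] obtain R2 where R2:
    "run program (tm main_com st) (96, R1) = (96 + clen main_com, R2)" "repr st3 R2"
    using sem by auto
  have "R2 0 = 2 * B + 32" using R2(2) fi(1) by (simp add: repr_def)
  then have ep: "run program 94 (96 + clen main_com, R2) =
      (96 + clen main_com + 94, \<lambda>a. if a < 32 then R2 (2 * B + 32 + a) else R2 a)" (is "_ = (_, ?R)")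
    using epilogue_run[OF ca(3), of R2] by (simp add: fun_eq_iff)
  have len: "length program = 96 + clen main_com + 94" by (simp add: program_def lp le)
  define t where "t = 96 + tm main_com st + 94"
  have run: "run program t (init w) = (length program, ?R)"
    unfolding t_def run_add R0(1) R1(1) R2(1) ep len ..
  have heap: "R2 (32 + a) = snd st3 a" for a using R2(2) by (simp add: repr_def)
  \<comment> \<open>For \<open>x < 32\<close> the epilogue loads register
    \<open>2 * B + 32 + x\<close>, which is heap cell \<open>2 * B + x\<close>; a later
    \<open>x\<close> is heap cell \<open>x - 32\<close>, filled by \<open>finish\<close>.\<close>
  have "?R x = color_of (snd st2) x" if "x < n" for x
    using fi(2)[OF that] fi(3)[OF that] heap[of "2 * B + x"] heap[of "x - 32"]
    by (auto simp: add_ac)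
  then have col: "C_coloring Es ?R \<and>
     real (n - card (?R ` {0..<n})) \<le> (1 + ln (real (length Es))) * real (dec {0..<n} Es)"
    using gr(2,3) by (intro greedy_inv_final[OF hypergraph host]) (auto simp: heap_inv_def)
  have "1 \<le> L ^ 4" "L \<le> L ^ 4" "L ^ 2 \<le> L ^ 4"
    using L self_le_power[of L 4] power_increasing[of 2 4 L] by simp_all
  \<comment> \<open>The contributions are \<open>96 + 94\<close>, 470, 148 and
    \<open>7 + 12\<close>, well below 1200.\<close>
  then have "t \<le> 1200 * L ^ 4"
    unfolding t_def sem using prep(4) gr(4) fi(4) by linarith
  also have "\<dots> \<le> 1200 * (L + 1) ^ 4" by (simp add: power_mono)
  finally show ?thesis using run col by blast
qed

end

theorem theorem3:
  "\<exists>(P :: instr list) (c :: nat) (k :: nat).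
     \<forall>(n :: nat) (Es :: nat set list) (Tl :: (nat \<times> nat) list).
       hypergraph {0..<n} Es \<and> host_tree {0..<n} Es (tree_edges Tl) \<longrightarrow>
       (\<exists>t. t \<le> c * (length (enc n Es Tl) + 1) ^ k \<and>
          halted P (run P t (init (enc n Es Tl))) \<and>
          (let \<phi> = snd (run P t (init (enc n Es Tl))) in
             C_coloring Es \<phi> \<and>
             real (n - card (\<phi> ` {0..<n}))
               \<le> (1 + ln (real (length Es))) * real (dec {0..<n} Es)))"
proof (rule exI[of _ program], rule exI[of _ 1200], rule exI[of _ 4], intro allI impI)
  fix n :: nat and Es :: "nat set list" and Tl :: "(nat \<times> nat) list"
  assume "hypergraph {0..<n} Es \<and> host_tree {0..<n} Es (tree_edges Tl)"
  then interpret hosted_hypertree n Es Tl by unfold_locales auto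
  obtain t R where "t \<le> 1200 * (L + 1) ^ 4" "run program t (init w) = (length program, R)"
    "C_coloring Es R"
    "real (n - card (R ` {0..<n})) \<le> (1 + ln (real (length Es))) * real (dec {0..<n} Es)"
    using program_run by blast
  then show "\<exists>t. t \<le> 1200 * (length (enc n Es Tl) + 1) ^ 4 \<and>
          halted program (run program t (init (enc n Es Tl))) \<and>
          (let \<phi> = snd (run program t (init (enc n Es Tl))) in
             C_coloring Es \<phi> \<and>
             real (n - card (\<phi> ` {0..<n}))
               \<le> (1 + ln (real (length Es))) * real (dec {0..<n} Es))"
    by (intro exI[of _ t]) (simp add: L_def w_def halted_def)
qed

end
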